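(* Let $\Phi$ be a root system of type $H_3$ or of dihedral type $I_2(m)$ ($m \geq 2$), with simple roots, positive roots $\Phi^+$, dominant chamber $C$, set $\mathcal{R}$ of dominant regions and set $\mathcal{I}$ of increasing sets in $(\Phi^+,\leq)$ as in the context. Then the map $f:\mathcal{R}\to\mathcal{I}$, $f(R)=I_R$, is a bijection.
   Context: Let $V$ be an $n$-dimensional real Euclidean space with inner product $(\cdot\mid\cdot)$. A root system $\Phi\subset V$ (not necessarily crystallographic, root lengths not necessarily equal) is a finite set of nonzero vectors such that $\Phi\cap\mathbb{R}\alpha=\{\alpha,-\alpha\}$ and $s_\alpha(\Phi)=\Phi$ for all $\alpha\in\Phi$, where $s_\alpha$ is the orthogonal reflection in $\alpha^\perp$. "Type $H_3$" means the group generated by the $s_\alpha$ is the Coxeter group with Coxeter graph $\circ_1\overset{5}{-}\circ_2-\circ_3$; "type $I_2(m)$" means it is the dihedral group of order $2m$ (for $m$ even the two orbits of roots may have any ratio of lengths). Fix simple roots $\Delta=\{\alpha_1,\dots,\alpha_n\}$ (a basis of $V$) and positive roots $\Phi^+=\{\beta\in\Phi:\beta=\sum c_i\alpha_i,\ c_i\geq 0\}$. The root order on $\Phi^+$: $\beta\leq\gamma$ iff $\gamma-\beta=\sum_i c_i\alpha_i$ with all $c_i\in\mathbb{R}_{\geq0}$. An increasing set is $I\subseteq\Phi^+$ such that $\beta\in I,\ \beta\leq\gamma\in\Phi^+$ imply $\gamma\in I$; $\mathcal{I}$ is the set of all increasing sets and $I^c=\Phi^+\setminus I$. Let $H_{\beta,c}=\{v\in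 V:(v\mid\beta)=c\}$, $H_{\beta,1}^+=\{v:(v\mid\beta)>1\}$, $H_{\beta,1}^-=\{v:(v\mid\beta)<1\}$, and $C=\{v\in V:(v\mid\alpha_i)>0\ \forall i\}$. A dominant region is a connected component of $V\setminus\bigcup_{\beta\in\Phi^+,\,c\in\{-1,0,1\}}H_{\beta,c}$ contained in $C$; $\mathcal{R}$ is the set of dominant regions. For $R\in\mathcal{R}$, $I_R=\{\beta\in\Phi^+:R\subseteq H_{\beta,1}^+\}$. *)

theory Defs
  imports "HOL-Analysis.Analysis" "HOL-Algebra.Elementary_Groups" "HOL-Algebra.Bij"
begin

definition reflection :: "'a::euclidean_space \<Rightarrow> 'a \<Rightarrow> 'a" where
  "reflection \<alpha> v = v - (2 * (v \<bullet> \<alpha>) / (\<alpha> \<bullet> \<alpha>)) *\<^sub>R \<alpha>"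

definition root_system :: "'a::euclidean_space set \<Rightarrow> bool" where
  "root_system \<Phi> \<longleftrightarrow> finite \<Phi> \<and> 0 \<notin> \<Phi> \<and>
     (\<forall>\<alpha>\<in>\<Phi>. \<Phi> \<inter> range (\<lambda>c. c *\<^sub>R \<alpha>) = {\<alpha>, - \<alpha>} \<and> reflection \<alpha> ` \<Phi> = \<Phi>)"

definition nonneg_comb :: "'a::euclidean_space set \<Rightarrow> 'a \<Rightarrow> bool" where
  "nonneg_comb \<Delta> v \<longleftrightarrow> (\<exists>c. (\<forall>\<alpha>\<in>\<Delta>. 0 \<le> c \<alpha>) \<and> v = (\<Sum>\<alpha>\<in>\<Delta>. c \<alpha> *\<^sub>R \<alpha>))"

text \<open>The simple roots are required to form a basis of the whole ambient space, so a root
  system with a simple system is essential.\<close>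

definition simple_system :: "'a::euclidean_space set \<Rightarrow> 'a set \<Rightarrow> bool" where
  "simple_system \<Phi> \<Delta> \<longleftrightarrow> \<Delta> \<subseteq> \<Phi> \<and> independent \<Delta> \<and> span \<Delta> = UNIV \<and>
     (\<forall>\<beta>\<in>\<Phi>. nonneg_comb \<Delta> \<beta> \<or> nonneg_comb \<Delta> (- \<beta>))"

definition reflection_group :: "'a::euclidean_space set \<Rightarrow> ('a \<Rightarrow> 'a) monoid" where
  "reflection_group \<Phi> = subgroup_generated (BijGroup UNIV) (reflection ` \<Phi>)"

text \<open>Equality of words over \<open>I\<close> in the Coxeter group
  \<open>\<langle>I | (i j)\<^bsup>m i j\<^esup> = 1\<rangle>\<close>. The relations for \<open>m i i = 1\<close> make the generators involutions,
  so words without inverses suffice; \<open>m i j = 0\<close> encodes the absence of a relation.\<close>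

inductive coxeter_eq :: "'i set \<Rightarrow> ('i \<Rightarrow> 'i \<Rightarrow> nat) \<Rightarrow> 'i list \<Rightarrow> 'i list \<Rightarrow> bool"
  for I m where
  relator: "i \<in> I \<Longrightarrow> j \<in> I \<Longrightarrow> coxeter_eq I m (concat (replicate (m i j) [i, j])) []"
| refl: "u \<in> lists I \<Longrightarrow> coxeter_eq I m u u"
| sym: "coxeter_eq I m u v \<Longrightarrow> coxeter_eq I m v u"
| trans: "coxeter_eq I m u v \<Longrightarrow> coxeter_eq I m v w \<Longrightarrow> coxeter_eq I m u w"
| append: "coxeter_eq I m u v \<Longrightarrow> coxeter_eq I m u' v' \<Longrightarrow> coxeter_eq I m (u @ u') (v @ v')"

definition word_prod :: "('g, 'b) monoid_scheme \<Rightarrow> ('i \<Rightarrow> 'g) \<Rightarrow> 'i list \<Rightarrow> 'g" where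
  "word_prod G s u = foldr (\<lambda>i g. s i \<otimes>\<^bsub>G\<^esub> g) u \<one>\<^bsub>G\<^esub>"

text \<open>\<open>G\<close> is the Coxeter group with Coxeter matrix \<open>m\<close> and Coxeter generators \<open>s i\<close>: the
  canonical map from the presented group to \<open>G\<close> is well defined, injective and surjective.\<close>

definition coxeter_system ::
    "('g, 'b) monoid_scheme \<Rightarrow> 'i set \<Rightarrow> ('i \<Rightarrow> 'g) \<Rightarrow> ('i \<Rightarrow> 'i \<Rightarrow> nat) \<Rightarrow> bool" where
  "coxeter_system G I s m \<longleftrightarrow> group G \<and> s \<in> I \<rightarrow> carrier G \<and> generate G (s ` I) = carrier G \<and>
     (\<forall>u\<in>lists I. \<forall>v\<in>lists I. word_prod G s u = word_prod G s v \<longleftrightarrow> coxeter_eq I m u v)"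

definition H3_matrix :: "nat \<Rightarrow> nat \<Rightarrow> nat" where
  "H3_matrix i j = (if i = j then 1
     else if {i, j} = {1, 2} then 5
     else if {i, j} = {2, 3} then 3
     else 2)"

definition type_H3 :: "'a::euclidean_space set \<Rightarrow> 'a set \<Rightarrow> bool" where
  "type_H3 \<Phi> \<Delta> \<longleftrightarrow> (\<exists>\<alpha>. bij_betw \<alpha> {1, 2, 3} \<Delta> \<and>
     coxeter_system (reflection_group \<Phi>) {1, 2, 3} (\<lambda>i. reflection (\<alpha> i)) H3_matrix)"

text \<open>\<open>(a, s)\<close> stands for the rotation \<open>r\<^bsup>a\<^esup>\<close> if \<open>s\<close> is false, and for \<open>r\<^bsup>a\<^esup> \<sigma>\<close> otherwise,
  where \<open>\<sigma>\<close> is a reflection with \<open>\<sigma> r \<sigma> = r\<^bsup>-1\<^esup>\<close>.\<close>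

definition dihedral_group :: "nat \<Rightarrow> (int \<times> bool) monoid" where
  "dihedral_group m = \<lparr>carrier = {0..<int m} \<times> UNIV,
     mult = (\<lambda>(a, s) (b, t). ((if s then a - b else a + b) mod int m, s \<noteq> t)),
     one = (0, False)\<rparr>"

lemma order_dihedral_group: "order (dihedral_group m) = 2 * m"
  by (simp add: order_def dihedral_group_def card_cartesian_product)

lemma group_dihedral_group:
  assumes "m > 0"
  shows "group (dihedral_group m)"
proof (rule groupI)
  fix x assume x: "x \<in> carrier (dihedral_group m)"
  obtain a s where as: "x = (a, s)" by (cases x)
  show "\<exists>y\<in>carrier (dihedral_group m). y \<otimes>\<^bsub>dihedral_group m\<^esub> x = \<one>\<^bsub>dihedral_group m\<^esub>"
    by (rule bexI[of _ "if s then x else ((- a) mod int m, False)"])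
      (use x as assms in \<open>auto simp: dihedral_group_def mod_simps\<close>)
qed (use assms in \<open>auto simp: dihedral_group_def mod_simps algebra_simps\<close>)

text \<open>The rank condition excludes reducible root systems whose group is abstractly dihedral,
  such as \<open>A\<^sub>1 \<times> A\<^sub>2\<close>.\<close>

definition type_I2 :: "nat \<Rightarrow> 'a::euclidean_space set \<Rightarrow> bool" where
  "type_I2 m \<Phi> \<longleftrightarrow> DIM('a) = 2 \<and> reflection_group \<Phi> \<cong> dihedral_group m"

definition positive_roots :: "'a::euclidean_space set \<Rightarrow> 'a set \<Rightarrow> 'a set" where
  "positive_roots \<Phi> \<Delta> = {\<beta>\<in>\<Phi>. nonneg_comb \<Delta> \<beta>}"

definition root_le :: "'a::euclidean_space set \<Rightarrow> 'a \<Rightarrow> 'a \<Rightarrow> bool" where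
  "root_le \<Delta> \<beta> \<gamma> \<longleftrightarrow> nonneg_comb \<Delta> (\<gamma> - \<beta>)"

definition increasing_sets :: "'a::euclidean_space set \<Rightarrow> 'a set \<Rightarrow> 'a set set" where
  "increasing_sets \<Phi> \<Delta> = {I. I \<subseteq> positive_roots \<Phi> \<Delta> \<and>
     (\<forall>\<beta>\<in>I. \<forall>\<gamma>\<in>positive_roots \<Phi> \<Delta>. root_le \<Delta> \<beta> \<gamma> \<longrightarrow> \<gamma> \<in> I)}"

definition root_hyperplane :: "'a::euclidean_space \<Rightarrow> real \<Rightarrow> 'a set" where
  "root_hyperplane \<beta> c = {v. v \<bullet> \<beta> = c}"

definition dominant_chamber :: "'a::euclidean_space set \<Rightarrow> 'a set" where
  "dominant_chamber \<Delta> = {v. \<forall>\<alpha>\<in>\<Delta>. v \<bullet> \<alpha> > 0}"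

definition dominant_regions :: "'a::euclidean_space set \<Rightarrow> 'a set \<Rightarrow> 'a set set" where
  "dominant_regions \<Phi> \<Delta> =
     {R \<in> components (UNIV - (\<Union>\<beta>\<in>positive_roots \<Phi> \<Delta>. \<Union>c\<in>{-1, 0, 1}. root_hyperplane \<beta> c)).
        R \<subseteq> dominant_chamber \<Delta>}"

definition region_roots :: "'a::euclidean_space set \<Rightarrow> 'a set \<Rightarrow> 'a set \<Rightarrow> 'a set" where
  "region_roots \<Phi> \<Delta> R = {\<beta> \<in> positive_roots \<Phi> \<Delta>. R \<subseteq> {v. v \<bullet> \<beta> > 1}}"

end

theory Submission
  imports Defs
begin

text \<open>
  Inside the dominant chamber the region of a point \<open>v\<close> is determined by the set of positive roots
  \<open>\<beta>\<close> with \<open>(v | \<beta>) > 1\<close>, and the points with a given set form a convex set. Hence \<open>R \<mapsto> I\<^sub>R\<close> is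
  injective, and surjectivity means that every increasing set \<open>I\<close> is separated from its complement
  in \<open>\<Phi>\<^sup>+\<close> by some hyperplane \<open>(v | \<cdot>) = 1\<close> with \<open>v\<close> dominant.

  In rank two, \<open>\<Phi>\<^sup>+\<close> is a union of two chains, obtained from either simple root by applying the two
  simple reflections alternately as long as this goes up. By Helly's theorem on the line of
  directions of \<open>v\<close> it is enough to satisfy two conditions \<open>(v | \<beta> - \<gamma>) > 0\<close> at a time
  (\<open>\<beta> \<in> I\<close>, \<open>\<gamma> \<notin> I\<close>). The critical case is \<open>\<beta>, \<gamma>'\<close> in one chain and \<open>\<beta>', \<gamma>\<close> in the other; then
  \<open>(\<beta> - \<gamma>) + (\<beta>' - \<gamma>') = (\<beta> - \<gamma>') + (\<beta>' - \<gamma>)\<close> is a nonzero nonnegative combination of simple roots,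
  so the two conditions cannot conflict.

  For \<open>H\<^sub>3\<close> the Coxeter relations together with the sign condition on roots determine the Cartan
  matrix, so the 15 positive roots are explicit over \<open>\<int>[(1 + \<surd>5) / 2]\<close>; the poset has 41 increasing
  sets, and each has a separating vector with rational coordinates \<open>(v | \<alpha>\<^sub>i)\<close>.
\<close>

lemma reflection_involution: "\<alpha> \<noteq> 0 \<Longrightarrow> reflection \<alpha> (reflection \<alpha> v) = v"
  by (simp add: reflection_def algebra_simps)

lemma reflection_inner: "\<alpha> \<noteq> 0 \<Longrightarrow> reflection \<alpha> v \<bullet> \<alpha> = - (v \<bullet> \<alpha>)"
  by (simp add: reflection_def algebra_simps)

subsection \<open>Regions and separating vectors\<close>

locale simple_root_system =
  fixes \<Phi> \<Delta> :: "'a::euclidean_space set"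
  assumes root_system: "root_system \<Phi>"
    and simple_system: "simple_system \<Phi> \<Delta>"
begin

abbreviation pos :: "'a set" where
  "pos \<equiv> positive_roots \<Phi> \<Delta>"

abbreviation coord :: "'a \<Rightarrow> 'a \<Rightarrow> real" where
  "coord v \<alpha> \<equiv> representation \<Delta> v \<alpha>"

lemma finite_roots: "finite \<Phi>"
  and zero_notin_roots: "0 \<notin> \<Phi>"
  using root_system by (auto simp: root_system_def)

lemma reflection_in_roots: "\<alpha> \<in> \<Phi> \<Longrightarrow> \<beta> \<in> \<Phi> \<Longrightarrow> reflection \<alpha> \<beta> \<in> \<Phi>"
  using root_system by (auto simp: root_system_def)

lemma multiple_in_roots:
  assumes "\<alpha> \<in> \<Phi>" "c *\<^sub>R \<alpha> \<in> \<Phi>"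
  shows "c = 1 \<or> c = -1"
proof -
  have "c *\<^sub>R \<alpha> \<in> \<Phi> \<inter> range (\<lambda>c. c *\<^sub>R \<alpha>)"
    using assms by auto
  then have "c *\<^sub>R \<alpha> = \<alpha> \<or> c *\<^sub>R \<alpha> = - \<alpha>"
    using root_system assms(1) by (auto simp: root_system_def)
  moreover have "\<alpha> \<noteq> 0"
    using assms(1) zero_notin_roots by auto
  ultimately show ?thesis
    by (metis scaleR_cancel_right scaleR_minus1_left scaleR_one)
qed

lemma simple_subset_roots: "\<Delta> \<subseteq> \<Phi>"
  and independent_simple: "independent \<Delta>"
  and span_simple: "span \<Delta> = UNIV"
  and root_sign: "\<beta> \<in> \<Phi> \<Longrightarrow> nonneg_comb \<Delta> \<beta> \<or> nonneg_comb \<Delta> (- \<beta>)"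
  using simple_system by (auto simp: simple_system_def)

lemma finite_simple: "finite \<Delta>"
  using independent_simple by (rule independent_imp_finite)

lemma card_simple: "card \<Delta> = DIM('a)"
  using real_vector.basis_card_eq_dim[of \<Delta> UNIV] independent_simple span_simple by simp

section \<open>Coordinates in the basis of simple roots\<close>

lemma coord_add: "coord (v + w) \<alpha> = coord v \<alpha> + coord w \<alpha>"
  and coord_diff: "coord (v - w) \<alpha> = coord v \<alpha> - coord w \<alpha>"
  and coord_minus: "coord (- v) \<alpha> = - coord v \<alpha>"
  and coord_scale: "coord (c *\<^sub>R v) \<alpha> = c * coord v \<alpha>"
  by (simp_all add: span_simple independent_simple real_vector.representation_add
      real_vector.representation_diff real_vector.representation_neg
      real_vector.representation_scale)

lemma coord_simple: "\<alpha> \<in> \<Delta> \<Longrightarrow> coord \<alpha> \<beta> = (if \<beta> = \<alpha> then 1 else 0)"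
  by (simp add: independent_simple real_vector.representation_basis)

lemmas coord_simps = coord_add coord_diff coord_minus coord_scale coord_simple

lemma sum_coord: "(\<Sum>\<alpha>\<in>\<Delta>. coord v \<alpha> *\<^sub>R \<alpha>) = v"
  using real_vector.sum_representation_eq[of \<Delta> v \<Delta>]
  by (simp add: span_simple independent_simple finite_simple)

lemma coord_sum: "\<alpha> \<in> \<Delta> \<Longrightarrow> coord (\<Sum>\<beta>\<in>\<Delta>. c \<beta> *\<^sub>R \<beta>) \<alpha> = c \<alpha>"
  using real_vector.representation_sum[of \<Delta> \<Delta> "\<lambda>\<beta>. c \<beta> *\<^sub>R \<beta>"]
  by (simp add: span_simple independent_simple coord_scale coord_simple finite_simple
      if_distrib[of "\<lambda>x. _ * x"] cong: sum.cong if_cong)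

lemma nonneg_comb_iff: "nonneg_comb \<Delta> v \<longleftrightarrow> (\<forall>\<alpha>\<in>\<Delta>. 0 \<le> coord v \<alpha>)"
proof
  assume "nonneg_comb \<Delta> v"
  then obtain c where "\<forall>\<alpha>\<in>\<Delta>. 0 \<le> c \<alpha>" "v = (\<Sum>\<alpha>\<in>\<Delta>. c \<alpha> *\<^sub>R \<alpha>)"
    unfolding nonneg_comb_def by blast
  then show "\<forall>\<alpha>\<in>\<Delta>. 0 \<le> coord v \<alpha>"
    by (simp add: coord_sum)
next
  assume "\<forall>\<alpha>\<in>\<Delta>. 0 \<le> coord v \<alpha>"
  then show "nonneg_comb \<Delta> v"
    unfolding nonneg_comb_def by (intro exI[of _ "coord v"]) (simp add: sum_coord)
qed

lemma coord_eqI: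
  assumes "\<And>\<alpha>. \<alpha> \<in> \<Delta> \<Longrightarrow> coord v \<alpha> = coord w \<alpha>"
  shows "v = w"
proof -
  have "(\<Sum>\<alpha>\<in>\<Delta>. coord v \<alpha> *\<^sub>R \<alpha>) = (\<Sum>\<alpha>\<in>\<Delta>. coord w \<alpha> *\<^sub>R \<alpha>)"
    using assms by (intro sum.cong) auto
  then show ?thesis
    by (simp only: sum_coord)
qed

lemma inner_eq_sum_coord: "v \<bullet> w = (\<Sum>\<alpha>\<in>\<Delta>. coord w \<alpha> * (v \<bullet> \<alpha>))"
proof -
  have "v \<bullet> (\<Sum>\<alpha>\<in>\<Delta>. coord w \<alpha> *\<^sub>R \<alpha>) = (\<Sum>\<alpha>\<in>\<Delta>. coord w \<alpha> * (v \<bullet> \<alpha>))"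
    by (simp only: inner_sum_right inner_scaleR_right)
  then show ?thesis
    by (simp only: sum_coord)
qed

lemma finite_pos: "finite pos"
  using finite_roots by (simp add: positive_roots_def)

lemma simple_subset_pos: "\<Delta> \<subseteq> pos"
  using simple_subset_roots by (auto simp: positive_roots_def nonneg_comb_iff coord_simple)

text \<open>A functional with prescribed values on the basis \<open>\<Delta>\<close> is represented
  by a vector, namely its adjoint applied to 1. Dominant vectors are specified below by their inner
  products with the simple roots.\<close>

lemma dual_vector_exists: "\<exists>v. \<forall>\<alpha>\<in>\<Delta>. v \<bullet> \<alpha> = f \<alpha>"
proof -
  obtain g :: "'a \<Rightarrow> real" where g: "linear g" "\<forall>\<alpha>\<in>\<Delta>. g \<alpha> = f \<alpha>"
    using linear_independent_extend[OF independent_simple, of f] by auto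
  have "adjoint g 1 \<bullet> x = g x" for x
    using adjoint_works[OF g(1), of x 1] by (simp add: inner_commute)
  then show ?thesis
    using g(2) by (intro exI[of _ "adjoint g 1"]) simp
qed

lemma nonneg_comb_inner:
  assumes "v \<in> dominant_chamber \<Delta>" "nonneg_comb \<Delta> w"
  shows "0 \<le> v \<bullet> w"
  using assms unfolding inner_eq_sum_coord[of v w]
  by (intro sum_nonneg mult_nonneg_nonneg) (auto simp: nonneg_comb_iff dominant_chamber_def
      less_imp_le)

lemma nonneg_comb_inner_pos:
  assumes "v \<in> dominant_chamber \<Delta>" "nonneg_comb \<Delta> w" "w \<noteq> 0"
  shows "0 < v \<bullet> w"
proof -
  obtain \<alpha> where \<alpha>: "\<alpha> \<in> \<Delta>" "coord w \<alpha> \<noteq> 0"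
    using assms(3) coord_eqI[of w 0] by (auto simp: real_vector.representation_zero)
  show ?thesis
    unfolding inner_eq_sum_coord[of v w]
    by (rule sum_pos2[OF finite_simple \<alpha>(1)])
      (use assms \<alpha> in \<open>auto simp: nonneg_comb_iff dominant_chamber_def less_le\<close>)
qed

lemma pos_inner_pos: "v \<in> dominant_chamber \<Delta> \<Longrightarrow> \<beta> \<in> pos \<Longrightarrow> 0 < v \<bullet> \<beta>"
  using nonneg_comb_inner_pos zero_notin_roots by (auto simp: positive_roots_def)

lemma root_le_inner: "v \<in> dominant_chamber \<Delta> \<Longrightarrow> root_le \<Delta> \<beta> \<gamma> \<Longrightarrow> v \<bullet> \<beta> \<le> v \<bullet> \<gamma>"
  using nonneg_comb_inner[of v "\<gamma> - \<beta>"] by (simp add: root_le_def inner_diff_right)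

lemma root_le_iff: "root_le \<Delta> v w \<longleftrightarrow> (\<forall>\<alpha>\<in>\<Delta>. coord v \<alpha> \<le> coord w \<alpha>)"
  by (simp add: root_le_def nonneg_comb_iff coord_diff)

text \<open>Both inequalities are strict, so \<open>v\<close> avoids the hyperplanes with constant
  1; dominance keeps it off those with constants 0 and -1.\<close>

definition separates :: "'a \<Rightarrow> 'a set \<Rightarrow> bool" where
  "separates v I \<longleftrightarrow>
     v \<in> dominant_chamber \<Delta> \<and> (\<forall>\<beta>\<in>I. 1 < v \<bullet> \<beta>) \<and> (\<forall>\<beta>\<in>pos - I. v \<bullet> \<beta> < 1)"

lemma separates_iff:
  assumes "separates v I" "\<beta> \<in> pos"
  shows "\<beta> \<in> I \<longleftrightarrow> 1 < v \<bullet> \<beta>" "v \<bullet> \<beta> \<noteq> 1" "0 < v \<bullet> \<beta>"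
proof -
  have "(\<beta> \<in> I \<longrightarrow> 1 < v \<bullet> \<beta>) \<and> (\<beta> \<notin> I \<longrightarrow> v \<bullet> \<beta> < 1) \<and> 0 < v \<bullet> \<beta>"
    using assms pos_inner_pos unfolding separates_def by blast
  then show "\<beta> \<in> I \<longleftrightarrow> 1 < v \<bullet> \<beta>" "v \<bullet> \<beta> \<noteq> 1" "0 < v \<bullet> \<beta>"
    by auto
qed

text \<open>An intersection of open half-spaces. Convexity is used only through connectedness, to
  place this set inside a single component.\<close>

lemma convex_separates: "convex {v. separates v I}"
proof -
  have "separates v I \<longleftrightarrow> (\<forall>\<alpha>\<in>\<Delta>. \<alpha> \<bullet> v > 0) \<and> (\<forall>\<beta>\<in>I. \<beta> \<bullet> v > 1) \<and> (\<forall>\<beta>\<in>pos - I. \<beta> \<bullet> v < 1)" for v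
    by (simp add: separates_def dominant_chamber_def inner_commute)
  then have "{v. separates v I} = (\<Inter>\<alpha>\<in>\<Delta>. {v. \<alpha> \<bullet> v > 0}) \<inter> (\<Inter>\<beta>\<in>I. {v. \<beta> \<bullet> v > 1}) \<inter>
      (\<Inter>\<beta>\<in>pos - I. {v. \<beta> \<bullet> v < 1})"
    by blast
  then show ?thesis
    by (simp only:) (intro convex_Int convex_INT convex_halfspace_gt convex_halfspace_lt)
qed

abbreviation arrangement_complement :: "'a set" where
  "arrangement_complement \<equiv>
     UNIV - (\<Union>\<beta>\<in>pos. \<Union>c\<in>{-1, 0, 1}. root_hyperplane \<beta> c)"

lemma separates_in_complement:
  assumes "separates v I"
  shows "v \<in> arrangement_complement"
proof -
  have "v \<bullet> \<beta> \<noteq> -1 \<and> v \<bullet> \<beta> \<noteq> 0 \<and> v \<bullet> \<beta> \<noteq> 1" if "\<beta> \<in> pos" for \<beta>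
    using separates_iff[OF assms that] by auto
  then show ?thesis
    by (auto simp: root_hyperplane_def)
qed

text \<open>By the intermediate value property, a connected set with points on both sides of a
  hyperplane would meet it.\<close>

lemma connected_same_side:
  assumes "connected R" "R \<subseteq> arrangement_complement" "v \<in> R" "w \<in> R" "\<beta> \<in> pos" "c \<in> {-1, 0, 1}"
  shows "c < v \<bullet> \<beta> \<longleftrightarrow> c < w \<bullet> \<beta>"
proof -
  have *: "\<not> (x \<bullet> \<beta> \<le> c \<and> c \<le> y \<bullet> \<beta>)" if xy: "x \<in> R" "y \<in> R" for x y
  proof
    assume le: "x \<bullet> \<beta> \<le> c \<and> c \<le> y \<bullet> \<beta>"
    obtain z where "z \<in> R" "z \<bullet> \<beta> = c"
      using connected_ivt_hyperplane[OF assms(1) xy, of \<beta> c] le by (auto simp: inner_commute)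
    then show False
      using assms by (auto simp: root_hyperplane_def)
  qed
  show ?thesis
    using *[of v w] *[of w v] assms by auto
qed

text \<open>All points of \<open>R\<close> lie on the same side of each hyperplane, which gives one
  inclusion. Conversely, the right-hand side is connected, avoids the arrangement and meets
  \<open>R\<close>, so it lies in the component \<open>R\<close>. Thus \<open>R\<close> can be
  recovered from \<open>I\<^sub>R\<close>.\<close>

lemma region_eq_separates:
  assumes "R \<in> dominant_regions \<Phi> \<Delta>"
  shows "R = {v. separates v (region_roots \<Phi> \<Delta> R)}"
proof -
  have R: "R \<in> components arrangement_complement" "R \<subseteq> dominant_chamber \<Delta>"
    using assms by (auto simp: dominant_regions_def)
  have conn: "connected R" and sub: "R \<subseteq> arrangement_complement" and ne: "R \<noteq> {}"
    using R(1) by (auto dest: in_components_connected in_components_subset in_components_nonempty)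
  have "separates v (region_roots \<Phi> \<Delta> R)" if v: "v \<in> R" for v
  proof -
    have "v \<bullet> \<beta> < 1" if \<beta>: "\<beta> \<in> pos - region_roots \<Phi> \<Delta> R" for \<beta>
    proof -
      obtain w where "w \<in> R" "\<not> 1 < w \<bullet> \<beta>"
        using \<beta> by (auto simp: region_roots_def)
      then have "\<not> 1 < v \<bullet> \<beta>"
        using connected_same_side[OF conn sub v, of w \<beta> 1] that by auto
      moreover have "v \<bullet> \<beta> \<noteq> 1"
        using sub v that by (auto simp: root_hyperplane_def)
      ultimately show ?thesis by simp
    qed
    then show ?thesis
      using v R by (auto simp: separates_def region_roots_def)
  qed
  then have 1: "R \<subseteq> {v. separates v (region_roots \<Phi> \<Delta> R)}"
    by auto
  have "{v. separates v (region_roots \<Phi> \<Delta> R)} \<subseteq> R"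
    by (rule components_maximal[OF R(1) convex_connected[OF convex_separates]])
      (use separates_in_complement 1 ne in auto)
  with 1 show ?thesis by auto
qed

text \<open>Injectivity is \<open>region_eq_separates\<close>, and \<open>I\<^sub>R\<close> is
  increasing because a dominant vector is monotone for the root order. The preimage of
  \<open>I\<close> is the component of a separating vector, so only the existence of such a vector
  remains.\<close>

theorem region_roots_bij:
  assumes sep: "\<And>I. I \<in> increasing_sets \<Phi> \<Delta> \<Longrightarrow> \<exists>v. separates v I"
  shows "bij_betw (region_roots \<Phi> \<Delta>) (dominant_regions \<Phi> \<Delta>) (increasing_sets \<Phi> \<Delta>)"
proof (rule bij_betwI')
  fix R R' assume "R \<in> dominant_regions \<Phi> \<Delta>" "R' \<in> dominant_regions \<Phi> \<Delta>"
  then show "region_roots \<Phi> \<Delta> R = region_roots \<Phi> \<Delta> R' \<longleftrightarrow> R = R'"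
    using region_eq_separates by metis
next
  fix R assume R: "R \<in> dominant_regions \<Phi> \<Delta>"
  have "1 < v \<bullet> \<gamma>" if "v \<in> R" "1 < v \<bullet> \<beta>" "root_le \<Delta> \<beta> \<gamma>" for v \<beta> \<gamma>
    using R that root_le_inner[of v \<beta> \<gamma>] by (force simp: dominant_regions_def)
  then show "region_roots \<Phi> \<Delta> R \<in> increasing_sets \<Phi> \<Delta>"
    by (auto simp: increasing_sets_def region_roots_def)
next
  fix I assume I: "I \<in> increasing_sets \<Phi> \<Delta>"
  then obtain v where v: "separates v I"
    using sep by auto
  define R where "R = connected_component_set arrangement_complement v"
  have vc: "v \<in> arrangement_complement"
    using v by (rule separates_in_complement)
  have R: "R \<in> components arrangement_complement" and vR: "v \<in> R"
    using vc by (auto simp: R_def components_def)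
  have conn: "connected R" and sub: "R \<subseteq> arrangement_complement"
    using R by (auto dest: in_components_connected in_components_subset)
  note side = connected_same_side[OF conn sub vR]
  have "w \<bullet> \<alpha> > 0" if "w \<in> R" "\<alpha> \<in> \<Delta>" for w \<alpha>
    using side[of w \<alpha> 0] that v simple_subset_pos by (auto simp: separates_def dominant_chamber_def)
  then have "R \<in> dominant_regions \<Phi> \<Delta>"
    using R by (auto simp: dominant_regions_def dominant_chamber_def)
  moreover have "\<beta> \<in> I \<longleftrightarrow> R \<subseteq> {w. 1 < w \<bullet> \<beta>}" if "\<beta> \<in> pos" for \<beta>
    using separates_iff(1)[OF v that] side[of _ \<beta> 1] that vR by blast
  then have "I = region_roots \<Phi> \<Delta> R"
    using I by (auto simp: region_roots_def increasing_sets_def)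
  ultimately show "\<exists>R\<in>dominant_regions \<Phi> \<Delta>. I = region_roots \<Phi> \<Delta> R"
    by auto
qed

text \<open>Some threshold \<open>t\<close> lies strictly between the values of \<open>v\<close> on
  the complement and those on \<open>I\<close>; dividing \<open>v\<close> by \<open>t\<close> moves
  it to 1.\<close>

lemma separates_if_inner_less:
  assumes v: "v \<in> dominant_chamber \<Delta>" and "I \<subseteq> pos"
    and less: "\<And>\<beta> \<gamma>. \<beta> \<in> I \<Longrightarrow> \<gamma> \<in> pos - I \<Longrightarrow> v \<bullet> \<gamma> < v \<bullet> \<beta>"
  shows "\<exists>c. separates (c *\<^sub>R v) I"
proof -
  \<comment> \<open>The inserted 0 covers an empty complement and makes \<open>M\<close>
    nonnegative, hence the threshold positive. In the next line \<open>M + 1\<close> serves as the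
    minimum if \<open>I\<close> is empty.\<close>
  define M where "M = Max (insert 0 ((\<bullet>) v ` (pos - I)))"
  define m where "m = Min (insert (M + 1) ((\<bullet>) v ` I))"
  have fin: "finite I" "finite (pos - I)"
    using assms(2) finite_pos finite_subset by auto
  have M: "0 \<le> M" "\<And>\<gamma>. \<gamma> \<in> pos - I \<Longrightarrow> v \<bullet> \<gamma> \<le> M"
    using fin by (auto simp: M_def)
  have "M \<in> insert 0 ((\<bullet>) v ` (pos - I))"
    unfolding M_def using fin by (intro Max_in) auto
  then have "M < v \<bullet> \<beta>" if "\<beta> \<in> I" for \<beta>
    using less[OF that] that pos_inner_pos[OF v] assms(2) by auto
  then have "M < m" and m: "\<And>\<beta>. \<beta> \<in> I \<Longrightarrow> m \<le> v \<bullet> \<beta>"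
    using fin by (auto simp: m_def)
  define t where "t = (M + m) / 2"
  have t: "0 < t" "M < t" "t < m"
    using \<open>M < m\<close> M(1) by (auto simp: t_def)
  have "t < v \<bullet> \<beta>" if "\<beta> \<in> I" for \<beta>
    using m[OF that] t by simp
  moreover have "v \<bullet> \<beta> < t" if "\<beta> \<in> pos - I" for \<beta>
    using M(2)[OF that] t by simp
  ultimately have "separates ((1 / t) *\<^sub>R v) I"
    using v t by (auto simp: separates_def dominant_chamber_def field_simps)
  then show ?thesis by blast
qed

subsection \<open>Simple reflections\<close>

lemma reflection_coord:
  assumes "\<alpha> \<in> \<Delta>" "\<gamma> \<noteq> \<alpha>"
  shows "coord (reflection \<alpha> v) \<gamma> = coord v \<gamma>"
  using assms by (simp add: reflection_def coord_simps)

text \<open>Otherwise the root \<open>reflection \<alpha> \<beta>\<close> would have a negative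
  coordinate at \<open>\<alpha>\<close> and coordinate 1 at \<open>\<beta>\<close>.\<close>

lemma simple_inner_nonpos:
  assumes "\<alpha> \<in> \<Delta>" "\<beta> \<in> \<Delta>" "\<alpha> \<noteq> \<beta>"
  shows "\<alpha> \<bullet> \<beta> \<le> 0"
proof (rule ccontr)
  assume "\<not> \<alpha> \<bullet> \<beta> \<le> 0"
  moreover have "\<alpha> \<noteq> 0"
    using assms simple_subset_roots zero_notin_roots by blast
  ultimately have "coord (reflection \<alpha> \<beta>) \<alpha> < 0" "coord (reflection \<alpha> \<beta>) \<beta> = 1"
    using assms by (simp_all add: reflection_def coord_simps inner_commute)
  moreover have "reflection \<alpha> \<beta> \<in> \<Phi>"
    using assms simple_subset_roots reflection_in_roots by auto
  ultimately show False
    using root_sign assms by (fastforce simp: nonneg_comb_iff coord_minus)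
qed

text \<open>The reflection changes only the coordinate at \<open>\<alpha>\<close>. A positive root
  other than \<open>\<alpha>\<close> is not a multiple of \<open>\<alpha>\<close>, so some other
  coordinate is positive and stays so, which decides the sign of the image.\<close>

lemma reflection_pos:
  assumes "\<alpha> \<in> \<Delta>" "\<beta> \<in> pos" "\<beta> \<noteq> \<alpha>"
  shows "reflection \<alpha> \<beta> \<in> pos"
proof -
  have "\<exists>\<gamma>\<in>\<Delta>. \<gamma> \<noteq> \<alpha> \<and> 0 < coord \<beta> \<gamma>"
  proof (rule ccontr)
    assume "\<not> ?thesis"
    then have z: "coord \<beta> \<gamma> = 0" if "\<gamma> \<in> \<Delta>" "\<gamma> \<noteq> \<alpha>" for \<gamma>
      using that assms(2) by (fastforce simp: positive_roots_def nonneg_comb_iff)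
    have eq: "\<beta> = coord \<beta> \<alpha> *\<^sub>R \<alpha>"
      by (rule coord_eqI) (use z assms in \<open>auto simp: coord_simps\<close>)
    have "coord \<beta> \<alpha> = 1 \<or> coord \<beta> \<alpha> = -1"
      by (rule multiple_in_roots[of \<alpha>])
        (use assms simple_subset_roots in \<open>auto simp: positive_roots_def simp flip: eq\<close>)
    moreover have "0 \<le> coord \<beta> \<alpha>"
      using assms by (auto simp: positive_roots_def nonneg_comb_iff)
    ultimately show False
      using eq assms(3) by auto
  qed
  then obtain \<gamma> where "\<gamma> \<in> \<Delta>" "0 < coord (reflection \<alpha> \<beta>) \<gamma>"
    using reflection_coord[OF assms(1)] by metis
  moreover have "reflection \<alpha> \<beta> \<in> \<Phi>"
    using assms simple_subset_roots reflection_in_roots by (auto simp: positive_roots_def)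
  ultimately show ?thesis
    using root_sign by (fastforce simp: positive_roots_def nonneg_comb_iff coord_minus)
qed

text \<open>\<open>\<beta> \<bullet> \<beta>\<close> is positive and is a nonnegative combination of
  the products \<open>\<beta> \<bullet> \<alpha>\<close>.\<close>

lemma exists_simple_inner_pos:
  assumes "\<beta> \<in> pos"
  shows "\<exists>\<alpha>\<in>\<Delta>. 0 < \<beta> \<bullet> \<alpha>"
proof (rule ccontr)
  assume "\<not> ?thesis"
  then have "\<beta> \<bullet> \<beta> \<le> 0"
    unfolding inner_eq_sum_coord[of \<beta> \<beta>] using assms
    by (intro sum_nonpos) (auto simp: positive_roots_def nonneg_comb_iff not_less
        intro!: mult_nonneg_nonpos)
  then have "\<beta> = 0"
    by (metis inner_gt_zero_iff not_less)
  then show False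
    using assms zero_notin_roots by (auto simp: positive_roots_def)
qed

text \<open>Reflecting a non-simple positive root in a simple root with positive inner product
  lowers it. Read backwards, every positive root arises from a simple one by reflections that raise
  it.\<close>

lemma pos_root_induct [consumes 1, case_names simple step]:
  assumes "\<beta> \<in> pos"
    and simple: "\<And>\<alpha>. \<alpha> \<in> \<Delta> \<Longrightarrow> P \<alpha>"
    and step: "\<And>\<beta> \<alpha>. \<beta> \<in> pos \<Longrightarrow> P \<beta> \<Longrightarrow> \<alpha> \<in> \<Delta> \<Longrightarrow> \<beta> \<bullet> \<alpha> < 0 \<Longrightarrow> P (reflection \<alpha> \<beta>)"
  shows "P \<beta>"
proof -
  \<comment> \<open>Pairing with \<open>v\<close> gives the height, the sum of the coordinates.
    Heights are real numbers, so the induction below runs over the number of positive roots of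
    smaller height.\<close>
  obtain v where v: "\<forall>\<alpha>\<in>\<Delta>. v \<bullet> \<alpha> = 1"
    using dual_vector_exists[of "\<lambda>_. 1"] by auto
  show ?thesis
    using assms(1)
  proof (induction "card {\<gamma> \<in> pos. v \<bullet> \<gamma> < v \<bullet> \<beta>}" arbitrary: \<beta> rule: less_induct)
    case less
    obtain \<alpha> where \<alpha>: "\<alpha> \<in> \<Delta>" "0 < \<beta> \<bullet> \<alpha>"
      using exists_simple_inner_pos[OF less.prems] by auto
    have "\<alpha> \<noteq> 0"
      using \<alpha> by auto
    define \<gamma> where "\<gamma> = reflection \<alpha> \<beta>"
    show ?case
    proof (cases "\<beta> = \<alpha>")
      case True
      then show ?thesis using simple \<alpha> by simp
    next
      case False
      have \<gamma>: "\<gamma> \<in> pos"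
        unfolding \<gamma>_def using \<alpha> less.prems False by (intro reflection_pos)
      have lt: "v \<bullet> \<gamma> < v \<bullet> \<beta>"
        using v \<alpha> \<open>\<alpha> \<noteq> 0\<close> by (simp add: \<gamma>_def reflection_def inner_diff_right)
      have "card {\<delta> \<in> pos. v \<bullet> \<delta> < v \<bullet> \<gamma>} < card {\<delta> \<in> pos. v \<bullet> \<delta> < v \<bullet> \<beta>}"
        using lt \<gamma> finite_pos by (intro psubset_card_mono) auto
      then have "P \<gamma>"
        using less.hyps \<gamma> by blast
      moreover have "\<gamma> \<bullet> \<alpha> < 0" "reflection \<alpha> \<gamma> = \<beta>"
        using \<alpha> \<open>\<alpha> \<noteq> 0\<close> by (auto simp: \<gamma>_def reflection_inner reflection_involution)
      ultimately show ?thesis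
        using step[of \<gamma> \<alpha>] \<gamma> \<alpha> by simp
    qed
  qed
qed

end

subsection \<open>Rank two\<close>

text \<open>Helly's theorem in dimension one. It concerns at least two distinct sets, so an empty
  index set and a family whose members all coincide are treated apart.\<close>

lemma finite_pairwise_Inter_real_nonempty:
  fixes S :: "'i \<Rightarrow> real set"
  assumes "finite J" and conv: "\<And>i. i \<in> J \<Longrightarrow> convex (S i)"
    and pair: "\<And>i j. i \<in> J \<Longrightarrow> j \<in> J \<Longrightarrow> S i \<inter> S j \<noteq> {}"
  shows "(\<Inter>i\<in>J. S i) \<noteq> {}"
proof (cases "card (S ` J) \<ge> 2")
  case True
  show ?thesis
  proof (rule Helly)
    show "DIM(real) + 1 \<le> card (S ` J)"
      using True by simp
    show "\<forall>s\<in>S ` J. convex s"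
      using conv by auto
  next
    fix t assume "t \<subseteq> S ` J" "card t = DIM(real) + 1"
    then have sub: "t \<subseteq> S ` J" and "card t = 2"
      by simp_all
    from \<open>card t = 2\<close> obtain A B where "t = {A, B}"
      unfolding card_2_iff by blast
    moreover from this sub obtain i j where "i \<in> J" "j \<in> J" "A = S i" "B = S j"
      by auto
    ultimately show "\<Inter> t \<noteq> {}"
      using pair[of i j] by simp
  qed
next
  case False
  then have "card (S ` J) = 0 \<or> card (S ` J) = 1"
    by linarith
  then consider "J = {}" | A where "S ` J = {A}"
    using \<open>finite J\<close> by (auto simp: card_1_singleton_iff)
  then show ?thesis
  proof cases
    case 2
    then obtain i where "i \<in> J" by blast
    moreover from this have "S i = A"
      using 2 by blast
    ultimately show ?thesis
      using pair[of i i] 2 by simp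
  qed auto
qed

section \<open>Linear inequalities in one positive unknown\<close>

lemma positive_functional_nonneg:
  fixes s u1 u2 :: real
  assumes "0 < s" "0 \<le> u1" "0 \<le> u2" "u1 \<noteq> 0 \<or> u2 \<noteq> 0"
  shows "0 < s * u1 + u2"
  using assms by (cases "u1 = 0") (auto intro: add_pos_nonneg)

lemma positive_functional_single:
  fixes u1 u2 :: real
  assumes "u1 > 0 \<or> u2 > 0"
  shows "\<exists>s>0. 0 < s * u1 + u2"
proof (cases "u1 > 0")
  case True
  then show ?thesis
    by (intro exI[of _ "(1 + \<bar>u2\<bar>) / u1"]) (auto simp: add_pos_nonneg)
next
  case False
  then have u: "u2 > 0" "u1 \<le> 0"
    using assms by auto
  \<comment> \<open>With this choice \<open>s * u1 + u2\<close> equals \<open>s\<close>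
    itself.\<close>
  define s where "s = u2 / (1 - u1)"
  have "s > 0" "s * (1 - u1) = u2"
    using u by (auto simp: s_def)
  then show ?thesis
    by (intro exI[of _ s]) (simp add: algebra_simps)
qed

text \<open>The conditions bound \<open>s\<close> below by \<open>- u2 / u1\<close> and above by
  \<open>w2 / (- w1)\<close>. The hypotheses on the sums give \<open>- w1 \<le> u1\<close> and
  \<open>- u2 \<le> w2\<close>, not both equalities, so the open interval between the bounds is
  nonempty.\<close>

lemma positive_functional_pair_crossing:
  fixes u1 u2 w1 w2 :: real
  assumes "u1 > 0" "u2 < 0" "w1 < 0" "w2 > 0" "0 \<le> u1 + w1" "0 \<le> u2 + w2"
    and "u1 + w1 \<noteq> 0 \<or> u2 + w2 \<noteq> 0"
  shows "\<exists>s>0. 0 < s * u1 + u2 \<and> 0 < s * w1 + w2"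
proof -
  have "(- u2) * (- w1) < w2 * u1"
  proof (cases "u1 + w1 = 0")
    case True
    then show ?thesis
      using assms by (intro mult_less_le_imp_less) auto
  next
    case False
    then show ?thesis
      using assms by (intro mult_le_less_imp_less) auto
  qed
  then have "- u2 / u1 < w2 / (- w1)"
    using assms by (simp add: field_simps)
  then obtain s where s: "- u2 / u1 < s" "s < w2 / (- w1)"
    using dense by blast
  have "0 < - u2 / u1"
    using assms by (simp add: field_simps)
  then have "0 < s"
    using s by linarith
  then show ?thesis
    using s assms by (intro exI[of _ s]) (simp add: field_simps)
qed

lemma positive_functional_pair:
  fixes u1 u2 w1 w2 :: real
  assumes u: "u1 > 0 \<or> u2 > 0" and w: "w1 > 0 \<or> w2 > 0"
    and sum: "0 \<le> u1 + w1" "0 \<le> u2 + w2" "u1 + w1 \<noteq> 0 \<or> u2 + w2 \<noteq> 0"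
  shows "\<exists>s>0. 0 < s * u1 + u2 \<and> 0 < s * w1 + w2"
proof -
  \<comment> \<open>A nonnegative nonzero pair holds for every positive \<open>s\<close>. If neither
    pair is nonnegative, each has mixed signs, and the sums force opposite patterns.\<close>
  consider "0 \<le> u1" "0 \<le> u2" | "0 \<le> w1" "0 \<le> w2"
    | "u1 > 0" "u2 < 0" "w1 < 0" "w2 > 0" | "w1 > 0" "w2 < 0" "u1 < 0" "u2 > 0"
    using u w sum by linarith
  then show ?thesis
  proof cases
    case 1
    then show ?thesis
      using positive_functional_single[OF w] positive_functional_nonneg[of _ u1 u2] u by auto
  next
    case 2
    then show ?thesis
      using positive_functional_single[OF u] positive_functional_nonneg[of _ w1 w2] w by auto
  next
    case 3
    then show ?thesis
      using positive_functional_pair_crossing[of u1 u2 w1 w2] sum by blast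
  next
    case 4
    then show ?thesis
      using positive_functional_pair_crossing[of w1 w2 u1 u2] sum by (auto simp: add.commute)
  qed
qed

section \<open>Chains of alternating simple reflections\<close>

definition alternating_letter :: "'a \<Rightarrow> 'a \<Rightarrow> nat \<Rightarrow> 'a" where
  "alternating_letter a b n = (if even n then b else a)"

text \<open>The first reflection is in \<open>b\<close>, since reflecting \<open>a\<close> in itself
  would give \<open>- a\<close>.\<close>

primrec alternating_root :: "'a::euclidean_space \<Rightarrow> 'a \<Rightarrow> nat \<Rightarrow> 'a" where
  "alternating_root a b 0 = a"
| "alternating_root a b (Suc n) = reflection (alternating_letter a b n) (alternating_root a b n)"

text \<open>Only indices reached by strictly raising reflections are kept, because later terms of
  the alternating sequence may descend again.\<close>

definition ascending_chain :: "'a::euclidean_space \<Rightarrow> 'a \<Rightarrow> 'a set" where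
  "ascending_chain a b = {alternating_root a b n | n.
     \<forall>i<n. alternating_root a b i \<bullet> alternating_letter a b i < 0}"

context simple_root_system
begin

lemma root_le_refl: "root_le \<Delta> v v"
  by (simp add: root_le_iff)

lemma root_le_trans: "root_le \<Delta> u v \<Longrightarrow> root_le \<Delta> v w \<Longrightarrow> root_le \<Delta> u w"
  by (force simp: root_le_iff)

lemma root_le_reflection:
  assumes "\<alpha> \<in> \<Delta>" "\<beta> \<bullet> \<alpha> < 0"
  shows "root_le \<Delta> \<beta> (reflection \<alpha> \<beta>)"
  using assms by (auto simp: root_le_iff reflection_def coord_simps mult_le_0_iff divide_le_0_iff)

lemma ascending_chain_comparable:
  assumes "{a, b} \<subseteq> \<Delta>" "x \<in> ascending_chain a b" "y \<in> ascending_chain a b"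
  shows "root_le \<Delta> x y \<or> root_le \<Delta> y x"
proof -
  have le: "root_le \<Delta> (alternating_root a b i) (alternating_root a b n)"
    if "i \<le> n" "\<forall>i<n. alternating_root a b i \<bullet> alternating_letter a b i < 0" for i n
    using that
  proof (induction rule: dec_induct)
    case (step n)
    have "alternating_letter a b n \<in> \<Delta>"
      using assms(1) by (simp add: alternating_letter_def)
    then show ?case
      using step root_le_trans root_le_reflection by simp
  qed (simp add: root_le_refl)
  obtain m where m: "x = alternating_root a b m"
    "\<forall>i<m. alternating_root a b i \<bullet> alternating_letter a b i < 0"
    using assms(2) by (auto simp: ascending_chain_def)
  obtain n where n: "y = alternating_root a b n"
    "\<forall>i<n. alternating_root a b i \<bullet> alternating_letter a b i < 0"
    using assms(3) by (auto simp: ascending_chain_def)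
  show ?thesis
    using le[of m n] le[of n m] m n by (cases "m \<le> n") auto
qed

text \<open>Only the next letter can raise the root: the other letter is the one just used, whose
  inner product with the root has become positive, or it is \<open>a\<close> itself at the
  start.\<close>

lemma ascending_chain_reflection:
  assumes "\<Delta> = {a, b}" "\<beta> \<in> ascending_chain a b" "\<alpha> \<in> \<Delta>" "\<beta> \<bullet> \<alpha> < 0"
  shows "reflection \<alpha> \<beta> \<in> ascending_chain a b"
proof -
  obtain n where n: "\<beta> = alternating_root a b n"
    "\<forall>i<n. alternating_root a b i \<bullet> alternating_letter a b i < 0"
    using assms(2) by (auto simp: ascending_chain_def)
  have "\<alpha> = alternating_letter a b n"
  proof (rule ccontr)
    assume neq: "\<alpha> \<noteq> alternating_letter a b n"
    show False
    proof (cases n)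
      case 0
      then have "\<beta> = a" "\<alpha> = a"
        using neq assms(1,3) n(1) by (auto simp: alternating_letter_def)
      then show False
        using assms(4) inner_ge_zero[of a] by simp
    next
      case (Suc k)
      then have "\<alpha> = alternating_letter a b k"
        using neq assms(1,3) by (auto simp: alternating_letter_def split: if_splits)
      moreover have "\<alpha> \<noteq> 0"
        using assms(4) by auto
      moreover have "alternating_root a b k \<bullet> alternating_letter a b k < 0"
        using n Suc by simp
      ultimately show False
        using n(1) Suc assms(4) by (simp add: reflection_inner)
    qed
  qed
  then have "reflection \<alpha> \<beta> = alternating_root a b (Suc n)"
    "\<forall>i<Suc n. alternating_root a b i \<bullet> alternating_letter a b i < 0"
    using n assms(4) by (simp_all add: less_Suc_eq)
  then show ?thesis
    unfolding ascending_chain_def by blast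
qed

lemma pos_subset_ascending_chains:
  assumes "\<Delta> = {a, b}"
  shows "pos \<subseteq> ascending_chain a b \<union> ascending_chain b a"
proof
  fix \<beta> assume "\<beta> \<in> pos"
  then show "\<beta> \<in> ascending_chain a b \<union> ascending_chain b a"
  proof (induction rule: pos_root_induct)
    case (simple \<alpha>)
    have "x \<in> ascending_chain x y" for x y :: 'a
      unfolding ascending_chain_def by (auto intro!: exI[of _ 0])
    then show ?case
      using simple assms by auto
  next
    case (step \<beta> \<alpha>)
    have "\<Delta> = {b, a}"
      using assms by auto
    then show ?case
      using ascending_chain_reflection[of a b \<beta> \<alpha>] ascending_chain_reflection[of b a \<beta> \<alpha>]
        step assms by blast
  qed
qed

theorem rank_two_separates:
  assumes "DIM('a) = 2" and I: "I \<in> increasing_sets \<Phi> \<Delta>"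
  shows "\<exists>v. separates v I"
proof -
  obtain a b where ab: "\<Delta> = {a, b}" "a \<noteq> b"
    using card_simple assms(1) by (auto simp: card_2_iff)
  have ball: "(\<forall>\<alpha>\<in>\<Delta>. p \<alpha>) \<longleftrightarrow> p a \<and> p b" for p
    using ab by auto
  define P where "P = ascending_chain a b"
  define Q where "Q = ascending_chain b a"
  \<comment> \<open>After normalising \<open>v \<bullet> b = 1\<close> and writing \<open>s\<close>
    for \<open>v \<bullet> a\<close>, the set \<open>S (\<beta>, \<gamma>)\<close> consists of the
    admissible \<open>s\<close> with
    \<open>v \<bullet> \<gamma> < v \<bullet> \<beta>\<close>.\<close>
  define S where "S = (\<lambda>(\<beta>, \<gamma>). {s. 0 < s \<and> 0 < s * coord (\<beta> - \<gamma>) a + coord (\<beta> - \<gamma>) b})"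
  have le_iff: "root_le \<Delta> x y \<longleftrightarrow> coord x a \<le> coord y a \<and> coord x b \<le> coord y b" for x y
    by (simp add: root_le_iff ball)
  have neq: "coord x a \<noteq> coord y a \<or> coord x b \<noteq> coord y b" if "x \<noteq> y" for x y
    using that coord_eqI[of x y] ball[of "\<lambda>\<alpha>. coord x \<alpha> = coord y \<alpha>"] by blast
  have "I \<subseteq> pos"
    using I by (simp add: increasing_sets_def)
  have upper: "\<not> root_le \<Delta> \<beta> \<gamma>" if "\<beta> \<in> I" "\<gamma> \<in> pos - I" for \<beta> \<gamma>
    using that I by (auto simp: increasing_sets_def)
  have cover: "x \<in> P \<or> x \<in> Q" if "x \<in> pos" for x
    using pos_subset_ascending_chains[OF ab(1)] that by (auto simp: P_def Q_def)
  have comparable: "root_le \<Delta> x y \<or> root_le \<Delta> y x" if "x \<in> P \<and> y \<in> P \<or> x \<in> Q \<and> y \<in> Q" for x y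
    using that ascending_chain_comparable[of a b x y] ascending_chain_comparable[of b a x y] ab
    by (auto simp: P_def Q_def)
  have single: "\<exists>s>0. 0 < s * coord (\<beta> - \<gamma>) a + coord (\<beta> - \<gamma>) b"
    if "\<beta> \<in> I" "\<gamma> \<in> pos - I" for \<beta> \<gamma>
    by (rule positive_functional_single) (use upper[OF that] in \<open>auto simp: le_iff coord_diff\<close>)
  have mono: "s * coord (x - y) a + coord (x - y) b \<le> s * coord (x' - y') a + coord (x' - y') b"
    if "0 < s" "root_le \<Delta> x x'" "root_le \<Delta> y' y" for s x y x' y'
    using that by (intro add_mono mult_left_mono) (auto simp: le_iff coord_diff)
  have pair: "S i \<inter> S j \<noteq> {}" if ij: "i \<in> I \<times> (pos - I)" "j \<in> I \<times> (pos - I)" for i j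
  proof -
    obtain \<beta> \<gamma> \<beta>' \<gamma>' where eq: "i = (\<beta>, \<gamma>)" "j = (\<beta>', \<gamma>')"
      and in_I: "\<beta> \<in> I" "\<gamma> \<in> pos - I" "\<beta>' \<in> I" "\<gamma>' \<in> pos - I"
      using ij by auto
    have comparable_neq: "root_le \<Delta> y x \<and> x \<noteq> y"
      if "x \<in> P \<and> y \<in> P \<or> x \<in> Q \<and> y \<in> Q" "x \<in> I" "y \<in> pos - I" for x y
      using that comparable upper by blast
    have "\<exists>s>0. 0 < s * coord (\<beta> - \<gamma>) a + coord (\<beta> - \<gamma>) b \<and>
        0 < s * coord (\<beta>' - \<gamma>') a + coord (\<beta>' - \<gamma>') b"
    proof -
      have nonneg: "0 < s * coord (x - y) a + coord (x - y) b"
        if "0 < s" "root_le \<Delta> y x \<and> x \<noteq> y" for s x y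
        by (rule positive_functional_nonneg)
          (use that neq[of x y] in \<open>auto simp: le_iff coord_diff\<close>)
      \<comment> \<open>If a pair lies in one chain, its condition holds for every positive
        \<open>s\<close>. Otherwise each pair uses both chains, and \<open>\<beta>\<close> shares
        its chain with either \<open>\<beta>'\<close> or \<open>\<gamma>'\<close>.\<close>
      consider "\<beta> \<in> P \<and> \<gamma> \<in> P \<or> \<beta> \<in> Q \<and> \<gamma> \<in> Q" | "\<beta>' \<in> P \<and> \<gamma>' \<in> P \<or> \<beta>' \<in> Q \<and> \<gamma>' \<in> Q"
        | "\<beta> \<in> P \<and> \<beta>' \<in> P \<or> \<beta> \<in> Q \<and> \<beta>' \<in> Q" "\<gamma> \<in> P \<and> \<gamma>' \<in> P \<or> \<gamma> \<in> Q \<and> \<gamma>' \<in> Q"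
        | "\<beta> \<in> P \<and> \<gamma>' \<in> P \<or> \<beta> \<in> Q \<and> \<gamma>' \<in> Q" "\<beta>' \<in> P \<and> \<gamma> \<in> P \<or> \<beta>' \<in> Q \<and> \<gamma> \<in> Q"
        using cover[of \<beta>] cover[of \<gamma>] cover[of \<beta>'] cover[of \<gamma>'] in_I \<open>I \<subseteq> pos\<close> by blast
      then show ?thesis
      proof cases
        case 1
        then show ?thesis
          using comparable_neq[of \<beta> \<gamma>] single[of \<beta>' \<gamma>'] nonneg in_I by blast
      next
        case 2
        then show ?thesis
          using comparable_neq[of \<beta>' \<gamma>'] single[of \<beta> \<gamma>] nonneg in_I by blast
      next
        case 3
        \<comment> \<open>The smaller of the two roots in \<open>I\<close> and the larger of the two
          outside it give one condition implying both.\<close>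
        obtain x where x: "x \<in> I" "root_le \<Delta> x \<beta>" "root_le \<Delta> x \<beta>'"
          using comparable[OF 3(1)] root_le_refl in_I by blast
        obtain y where y: "y \<in> pos - I" "root_le \<Delta> \<gamma> y" "root_le \<Delta> \<gamma>' y"
          using comparable[OF 3(2)] root_le_refl in_I by blast
        show ?thesis
          using single[OF x(1) y(1)] mono x y by (meson less_le_trans)
      next
        case 4
        have le: "root_le \<Delta> \<gamma>' \<beta>" "root_le \<Delta> \<gamma> \<beta>'" "\<beta> \<noteq> \<gamma>'"
          using comparable_neq[OF 4(1)] comparable_neq[OF 4(2)] in_I by auto
        show ?thesis
          by (rule positive_functional_pair)
            (use le neq[OF le(3)] upper[of \<beta> \<gamma>] upper[of \<beta>' \<gamma>'] in_I in \<open>auto simp: le_iff coord_diff\<close>)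
      qed
    qed
    then show ?thesis
      by (auto simp: S_def eq)
  qed
  have conv: "convex (S i)" for i
  proof -
    obtain \<beta> \<gamma> where i: "i = (\<beta>, \<gamma>)" by (cases i)
    have "S i = {s. 0 < s} \<inter> {s. - coord (\<beta> - \<gamma>) b < coord (\<beta> - \<gamma>) a \<bullet> s}"
      by (auto simp: S_def i mult.commute)
    moreover have "convex {s::real. 0 < s}"
      using convex_halfspace_gt[of "0::real" "1::real"] by simp
    ultimately show ?thesis
      by (simp only: convex_Int convex_halfspace_gt)
  qed
  have "(\<Inter>i\<in>I \<times> (pos - I). S i) \<noteq> {}"
    using \<open>I \<subseteq> pos\<close> finite_pos finite_subset conv pair
    by (intro finite_pairwise_Inter_real_nonempty) auto
  then obtain s0 where s0: "\<And>i. i \<in> I \<times> (pos - I) \<Longrightarrow> s0 \<in> S i"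
    by blast
  \<comment> \<open>Without any pair to separate, the intersection is the whole line and
    \<open>s0\<close> need not be positive.\<close>
  define s where "s = (if I \<times> (pos - I) = {} then 1 else s0)"
  have s: "0 < s" "\<And>\<beta> \<gamma>. \<beta> \<in> I \<Longrightarrow> \<gamma> \<in> pos - I \<Longrightarrow> 0 < s * coord (\<beta> - \<gamma>) a + coord (\<beta> - \<gamma>) b"
    using s0 by (fastforce simp: s_def S_def)+
  obtain v where v: "v \<bullet> a = s" "v \<bullet> b = 1"
    using dual_vector_exists[of "\<lambda>\<alpha>. if \<alpha> = a then s else 1"] ab(2) by (auto simp: ball)
  have dom: "v \<in> dominant_chamber \<Delta>"
    using v s by (simp add: dominant_chamber_def ball)
  have sum: "sum g \<Delta> = g a + g b" for g :: "'a \<Rightarrow> real"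
    using ab by simp
  have "v \<bullet> (\<beta> - \<gamma>) = s * coord (\<beta> - \<gamma>) a + coord (\<beta> - \<gamma>) b" for \<beta> \<gamma>
    unfolding inner_eq_sum_coord[of v "\<beta> - \<gamma>"] sum v by simp
  then have "v \<bullet> \<gamma> < v \<bullet> \<beta>" if "\<beta> \<in> I" "\<gamma> \<in> pos - I" for \<beta> \<gamma>
    using s(2)[OF that] by (metis diff_gt_0_iff_gt inner_diff_right)
  then show ?thesis
    using separates_if_inner_less[OF dom \<open>I \<subseteq> pos\<close>] by blast
qed

end

subsection \<open>The root poset of type \<open>H\<^sub>3\<close>\<close>

text \<open>Coefficients of the fifteen positive roots, with \<open>r\<close> standing for the
  golden ratio. The order is that of \<open>b0\<close> to \<open>b14\<close> below.\<close>

definition H3_coeffs :: "real \<Rightarrow> (real \<times> real \<times> real) set" where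
  "H3_coeffs r = {(1, 0, 0), (0, 1, 0), (0, 0, 1), (1, r, 0), (r, 1, 0),
     (0, 1, 1), (r, r, 0), (1, r, r), (r, 1, 1), (r, r, r),
     (r, r + 1, 1), (r, r + 1, r), (r + 1, r + 1, 1), (r + 1, r + 1, r), (r + 1, 2 * r, r)}"

definition side :: "bool \<Rightarrow> real \<Rightarrow> bool" where
  "side b t \<longleftrightarrow> (if b then 1 < t else t < 1)"

text \<open>\<open>b0\<close> to \<open>b14\<close> record which roots belong to the increasing set,
  and \<open>imps\<close> lists the cover relations of the root poset. In each case these fix all
  memberships. Separation is an open condition, so rational witnesses can be chosen, and the
  rational bounds on \<open>r\<close> then verify every inequality.\<close>

lemma golden_upset_separated:
  fixes r :: real
  assumes r: "1.618 < r" "r < 1.6181"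
    and imps: "b0 \<longrightarrow> b3" "b0 \<longrightarrow> b4" "b1 \<longrightarrow> b3" "b1 \<longrightarrow> b4" "b1 \<longrightarrow> b5"
      "b2 \<longrightarrow> b5" "b3 \<longrightarrow> b6" "b3 \<longrightarrow> b7" "b4 \<longrightarrow> b6" "b4 \<longrightarrow> b8"
      "b5 \<longrightarrow> b7" "b5 \<longrightarrow> b8" "b6 \<longrightarrow> b9" "b6 \<longrightarrow> b10" "b7 \<longrightarrow> b9"
      "b8 \<longrightarrow> b9" "b8 \<longrightarrow> b10" "b9 \<longrightarrow> b11" "b10 \<longrightarrow> b11" "b10 \<longrightarrow> b12"
      "b11 \<longrightarrow> b13" "b12 \<longrightarrow> b13" "b13 \<longrightarrow> b14"
  shows "\<exists>x y z. 0 < x \<and> 0 < y \<and> 0 < z \<and>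
    side b0 x \<and> side b1 y \<and>
    side b2 z \<and> side b3 (x + r * y) \<and>
    side b4 (r * x + y) \<and> side b5 (y + z) \<and>
    side b6 (r * x + r * y) \<and> side b7 (x + r * y + r * z) \<and>
    side b8 (r * x + y + z) \<and> side b9 (r * x + r * y + r * z) \<and>
    side b10 (r * x + (r + 1) * y + z) \<and> side b11 (r * x + (r + 1) * y + r * z) \<and>
    side b12 ((r + 1) * x + (r + 1) * y + z) \<and> side b13 ((r + 1) * x + (r + 1) * y + r * z) \<and>
    side b14 ((r + 1) * x + 2 * r * y + r * z)"
    (is "\<exists>x y z. ?sep x y z")
proof -
  have witness: "\<exists>x y z. ?sep x y z" if "?sep x y z" for x y z
    using that by blast
  \<comment> \<open>Each case names the minimal elements of an increasing set and the maximal elements of its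
    complement.\<close>
  consider
      "\<not> b14"
    | "b14" "\<not> b13"
    | "b13" "\<not> b11" "\<not> b12"
    | "b11" "\<not> b9" "\<not> b12"
    | "b9" "\<not> b7" "\<not> b12"
    | "b7" "\<not> b12"
    | "b12" "\<not> b11"
    | "b11" "b12" "\<not> b9" "\<not> b10"
    | "b9" "b12" "\<not> b7" "\<not> b10"
    | "b7" "b12" "\<not> b10"
    | "b10" "\<not> b9"
    | "b9" "b10" "\<not> b6" "\<not> b7" "\<not> b8"
    | "b6" "\<not> b7" "\<not> b8"
    | "b7" "b10" "\<not> b6" "\<not> b8"
    | "b6" "b7" "\<not> b3" "\<not> b8"
    | "b3" "\<not> b8"
    | "b8" "\<not> b6" "\<not> b7"
    | "b6" "b8" "\<not> b4" "\<not> b7"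
    | "b4" "\<not> b7"
    | "b7" "b8" "\<not> b5" "\<not> b6"
    | "b5" "\<not> b2" "\<not> b6"
    | "b2" "\<not> b6"
    | "b6" "b7" "b8" "\<not> b3" "\<not> b4" "\<not> b5"
    | "b3" "b8" "\<not> b4" "\<not> b5"
    | "b4" "b7" "\<not> b3" "\<not> b5"
    | "b3" "b4" "\<not> b0" "\<not> b5"
    | "b0" "\<not> b5"
    | "b5" "b6" "\<not> b2" "\<not> b3" "\<not> b4"
    | "b2" "b6" "\<not> b3" "\<not> b4"
    | "b3" "b5" "\<not> b2" "\<not> b4"
    | "b2" "b3" "\<not> b4"
    | "b4" "b5" "\<not> b2" "\<not> b3"
    | "b2" "b4" "\<not> b3"
    | "b3" "b4" "b5" "\<not> b0" "\<not> b1" "\<not> b2"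
    | "b0" "b5" "\<not> b1" "\<not> b2"
    | "b1" "\<not> b0" "\<not> b2"
    | "b0" "b1" "\<not> b2"
    | "b2" "b3" "b4" "\<not> b0" "\<not> b1"
    | "b0" "b2" "\<not> b1"
    | "b1" "b2" "\<not> b0"
    | "b0" "b1" "b2"
    \<comment> \<open>Exhaustiveness is purely propositional: every truth assignment compatible with
      \<open>imps\<close> falls under one of the 41 cases.\<close>
    using imps by satx
  then show ?thesis
  proof cases
    case 1
    with imps r show ?thesis
      by (intro witness[of "1/8" "1/8" "1/8"]) (simp add: side_def field_simps)
  next
    case 2
    with imps r show ?thesis
      by (intro witness[of "1/7" "1/7" "1/7"]) (simp add: side_def field_simps)
  next
    case 3
    with imps r show ?thesis
      by (intro witness[of "1/8" "1/8" "1/4"]) (simp add: side_def field_simps)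
  next
    case 4
    with imps r show ?thesis
      by (intro witness[of "1/9" "1/9" "1/3"]) (simp add: side_def field_simps)
  next
    case 5
    with imps r show ?thesis
      by (intro witness[of "1/11" "1/11" "5/11"]) (simp add: side_def field_simps)
  next
    case 6
    with imps r show ?thesis
      by (intro witness[of "1/12" "1/12" "1/2"]) (simp add: side_def field_simps)
  next
    case 7
    with imps r show ?thesis
      by (intro witness[of "1/6" "1/6" "1/6"]) (simp add: side_def field_simps)
  next
    case 8
    with imps r show ?thesis
      by (intro witness[of "1/7" "1/7" "2/7"]) (simp add: side_def field_simps)
  next
    case 9
    with imps r show ?thesis
      by (intro witness[of "1/8" "1/8" "3/8"]) (simp add: side_def field_simps)
  next
    case 10
    with imps r show ?thesis
      by (intro witness[of "1/9" "1/9" "4/9"]) (simp add: side_def field_simps)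
  next
    case 11
    with imps r show ?thesis
      by (intro witness[of "1/5" "1/5" "1/5"]) (simp add: side_def field_simps)
  next
    case 12
    with imps r show ?thesis
      by (intro witness[of "1/6" "1/6" "1/3"]) (simp add: side_def field_simps)
  next
    case 13
    with imps r show ?thesis
      by (intro witness[of "3/8" "1/4" "1/8"]) (simp add: side_def field_simps)
  next
    case 14
    with imps r show ?thesis
      by (intro witness[of "1/4" "1/4" "1/4"]) (simp add: side_def field_simps)
  next
    case 15
    with imps r show ?thesis
      by (intro witness[of "1/6" "1/2" "1/6"]) (simp add: side_def field_simps)
  next
    case 16
    with imps r show ?thesis
      by (intro witness[of "1/7" "4/7" "1/7"]) (simp add: side_def field_simps)
  next
    case 17
    with imps r show ?thesis
      by (intro witness[of "4/9" "1/9" "2/9"]) (simp add: side_def field_simps)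
  next
    case 18
    with imps r show ?thesis
      by (intro witness[of "1/2" "1/8" "1/8"]) (simp add: side_def field_simps)
  next
    case 19
    with imps r show ?thesis
      by (intro witness[of "5/9" "1/9" "1/9"]) (simp add: side_def field_simps)
  next
    case 20
    with imps r show ?thesis
      by (intro witness[of "1/4" "1/4" "1/2"]) (simp add: side_def field_simps)
  next
    case 21
    with imps r show ?thesis
      by (intro witness[of "1/5" "2/5" "4/5"]) (simp add: side_def field_simps)
  next
    case 22
    with imps r show ?thesis
      by (intro witness[of "1/4" "1/4" "5/4"]) (simp add: side_def field_simps)
  next
    case 23
    with imps r show ?thesis
      by (intro witness[of "1/3" "1/3" "1/3"]) (simp add: side_def field_simps)
  next
    case 24
    with imps r show ?thesis
      by (intro witness[of "1/4" "1/2" "1/4"]) (simp add: side_def field_simps)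
  next
    case 25
    with imps r show ?thesis
      by (intro witness[of "1/2" "1/4" "1/4"]) (simp add: side_def field_simps)
  next
    case 26
    with imps r show ?thesis
      by (intro witness[of "2/3" "1/3" "1/3"]) (simp add: side_def field_simps)
  next
    case 27
    with imps r show ?thesis
      by (intro witness[of "4/3" "1/3" "1/3"]) (simp add: side_def field_simps)
  next
    case 28
    with imps r show ?thesis
      by (intro witness[of "1/6" "1/2" "2/3"]) (simp add: side_def field_simps)
  next
    case 29
    with imps r show ?thesis
      by (intro witness[of "1/3" "1/3" "4/3"]) (simp add: side_def field_simps)
  next
    case 30
    with imps r show ?thesis
      by (intro witness[of "1/4" "1/2" "3/4"]) (simp add: side_def field_simps)
  next
    case 31
    with imps r show ?thesis
      by (intro witness[of "1/4" "1/2" "5/4"]) (simp add: side_def field_simps)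
  next
    case 32
    with imps r show ?thesis
      by (intro witness[of "1/2" "1/4" "7/8"]) (simp add: side_def field_simps)
  next
    case 33
    with imps r show ?thesis
      by (intro witness[of "1/2" "1/4" "5/4"]) (simp add: side_def field_simps)
  next
    case 34
    with imps r show ?thesis
      by (intro witness[of "1/3" "2/3" "2/3"]) (simp add: side_def field_simps)
  next
    case 35
    with imps r show ?thesis
      by (intro witness[of "4/3" "2/3" "2/3"]) (simp add: side_def field_simps)
  next
    case 36
    with imps r show ?thesis
      by (intro witness[of "1/2" "3/2" "1/2"]) (simp add: side_def field_simps)
  next
    case 37
    with imps r show ?thesis
      by (intro witness[of "3/2" "3/2" "1/2"]) (simp add: side_def field_simps)
  next
    case 38
    with imps r show ?thesis
      by (intro witness[of "1/2" "1/2" "3/2"]) (simp add: side_def field_simps)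
  next
    case 39
    with imps r show ?thesis
      by (intro witness[of "3/2" "1/2" "3/2"]) (simp add: side_def field_simps)
  next
    case 40
    with imps r show ?thesis
      by (intro witness[of "1/2" "3/2" "3/2"]) (simp add: side_def field_simps)
  next
    case 41
    with imps r show ?thesis
      by (intro witness[of "3/2" "3/2" "3/2"]) (simp add: side_def field_simps)
  qed
qed

subsection \<open>Type \<open>H\<^sub>3\<close>\<close>

lemma bij_reflection: "\<alpha> \<noteq> 0 \<Longrightarrow> bij (reflection \<alpha>)"
  by (rule involuntory_imp_bij) (rule reflection_involution)

lemma Bij_UNIV_iff: "f \<in> Bij UNIV \<longleftrightarrow> bij f"
  by (simp add: Bij_def)

text \<open>Bijectivity is carried through the induction because multiplication in
  \<open>BijGroup\<close> is composition only on bijections.\<close>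

lemma word_prod_reflection_group:
  assumes "\<forall>i\<in>set u. bij (s i)"
  shows "word_prod (reflection_group \<Phi>) s u = foldr (\<lambda>i. (\<circ>) (s i)) u id \<and>
    bij (foldr (\<lambda>i. (\<circ>) (s i)) u id)"
  using assms
proof (induction u)
  case Nil
  show ?case
    by (simp add: word_prod_def reflection_group_def BijGroup_def id_def[symmetric])
next
  case (Cons i u)
  let ?f = "foldr (\<lambda>i. (\<circ>) (s i)) u id"
  have i: "bij (s i)" and "\<forall>i\<in>set u. bij (s i)"
    using Cons.prems by simp_all
  then have IH: "word_prod (reflection_group \<Phi>) s u = ?f" "bij ?f"
    using Cons.IH by blast+
  have "word_prod (reflection_group \<Phi>) s (i # u) =
      s i \<otimes>\<^bsub>BijGroup UNIV\<^esub> word_prod (reflection_group \<Phi>) s u"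
    by (simp add: word_prod_def reflection_group_def)
  also have "\<dots> = s i \<circ> ?f"
    unfolding IH(1) using IH(2) i by (simp add: BijGroup_def Bij_UNIV_iff compose_def fun_eq_iff)
  finally show ?case
    using bij_comp[OF IH(2) i] unfolding foldr.simps comp_apply by blast
qed

lemma foldr_alternating_word:
  "foldr (\<lambda>i. (\<circ>) (s i)) (concat (replicate n [i, j])) id = (s i \<circ> s j) ^^ n"
  by (induction n) (auto simp: comp_assoc)

lemma coxeter_system_relation:
  assumes cox: "coxeter_system (reflection_group \<Phi>) I (\<lambda>i. reflection (\<alpha> i)) m"
    and ij: "i \<in> I" "j \<in> I" and nz: "\<alpha> i \<noteq> 0" "\<alpha> j \<noteq> 0"
  shows "(reflection (\<alpha> i) \<circ> reflection (\<alpha> j)) ^^ m i j = id"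
proof -
  let ?s = "\<lambda>i. reflection (\<alpha> i)" and ?u = "concat (replicate (m i j) [i, j])"
  have "coxeter_eq I m ?u []"
    using ij by (rule coxeter_eq.relator)
  moreover have u: "set ?u \<subseteq> {i, j}"
    by (auto split: if_splits)
  then have "?u \<in> lists I"
    using ij by auto
  ultimately have "word_prod (reflection_group \<Phi>) ?s ?u = word_prod (reflection_group \<Phi>) ?s []"
    using cox by (auto simp: coxeter_system_def)
  moreover have "\<forall>i\<in>set ?u. bij (?s i)"
    using nz u bij_reflection by blast
  ultimately show ?thesis
    using word_prod_reflection_group[of ?u ?s \<Phi>] word_prod_reflection_group[of "[]" ?s \<Phi>]
    by (simp add: foldr_alternating_word[of ?s])
qed

section \<open>The golden ratio\<close>

definition golden :: real where
  "golden = (1 + sqrt 5) / 2"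

lemma golden_square: "golden * golden = golden + 1"
  by (simp add: golden_def field_simps)

lemma golden_bounds: "1.618 < golden" "golden < 1.6181"
proof -
  have "2.236 < sqrt 5" "sqrt 5 < 2.2362"
    by (rule real_less_rsqrt real_less_lsqrt; simp add: power2_eq_square)+
  then show "1.618 < golden" "golden < 1.6181"
    by (auto simp: golden_def)
qed

section \<open>Cartan numbers of two simple roots\<close>

context simple_root_system
begin

text \<open>\<open>p\<close> and \<open>q\<close> are the negated Cartan numbers:
  \<open>reflection a b = b + p *\<^sub>R a\<close> and
  \<open>reflection b a = a + q *\<^sub>R b\<close>. They may differ, as the two roots may have
  different lengths.\<close>

context
  fixes a b :: 'a and p q :: real
  assumes ab: "a \<in> \<Delta>" "b \<in> \<Delta>" "a \<noteq> b"
  defines "p \<equiv> - 2 * (b \<bullet> a) / (a \<bullet> a)" and "q \<equiv> - 2 * (a \<bullet> b) / (b \<bullet> b)"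
begin

abbreviation plane :: "real \<Rightarrow> real \<Rightarrow> 'a" where
  "plane x y \<equiv> x *\<^sub>R a + y *\<^sub>R b"

lemma simple_pair_nonzero: "a \<noteq> 0" "b \<noteq> 0"
  using ab simple_subset_roots zero_notin_roots by auto

lemma reflection_plane:
  "reflection a (plane x y) = plane (p * y - x) y"
  "reflection b (plane x y) = plane x (q * x - y)"
proof -
  have "2 * (plane x y \<bullet> a) / (a \<bullet> a) = x + x - p * y" "2 * (plane x y \<bullet> b) / (b \<bullet> b) = y + y - q * x"
    using simple_pair_nonzero by (simp_all add: p_def q_def inner_add_left field_simps)
  then show "reflection a (plane x y) = plane (p * y - x) y"
    "reflection b (plane x y) = plane x (q * x - y)"
    unfolding reflection_def by (simp_all only: scaleR_add_left scaleR_diff_left) simp_all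
qed

lemma plane_eq_iff: "plane x y = plane x' y' \<longleftrightarrow> x = x' \<and> y = y'"
proof
  assume "plane x y = plane x' y'"
  then have "coord (plane x y) a = coord (plane x' y') a" "coord (plane x y) b = coord (plane x' y') b"
    by simp_all
  then show "x = x' \<and> y = y'"
    using ab by (simp add: coord_simps)
qed auto

lemma plane_root_sign:
  assumes "plane x y \<in> \<Phi>"
  shows "0 \<le> x \<and> 0 \<le> y \<or> x \<le> 0 \<and> y \<le> 0"
  using root_sign[OF assms] ab by (auto simp: nonneg_comb_iff coord_simps)

lemma Cartan_nonneg: "0 \<le> p" "0 \<le> q"
  using simple_inner_nonpos[OF ab] simple_inner_nonpos[OF ab(2,1)] ab(3)
  by (auto simp: p_def q_def divide_nonpos_nonneg)

lemma reflection_plane_in_roots: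
  assumes "plane x y \<in> \<Phi>"
  shows "plane (p * y - x) y \<in> \<Phi>" "plane x (q * x - y) \<in> \<Phi>"
  using assms ab simple_subset_roots reflection_in_roots reflection_plane by (metis subsetD)+

lemma plane_1_0_in_roots: "plane 1 0 \<in> \<Phi>"
  using ab simple_subset_roots by auto

lemma Cartan_order_two:
  assumes "(reflection a \<circ> reflection b) ^^ 2 = id"
  shows "p = 0" "q = 0"
proof -
  \<comment> \<open>Feeding in a word that cancels the innermost reflections splits the relation
    into an equality of two shorter words, here applied to \<open>a\<close>. The orders three and
    five are treated in the same way.\<close>
  have "((reflection a \<circ> reflection b) ^^ 2) (reflection b (reflection a (plane 1 0))) =
      reflection a (reflection b (plane 1 0))"
    using simple_pair_nonzero by (simp add: eval_nat_numeral reflection_involution)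
  then have "reflection b (reflection a (plane 1 0)) = reflection a (reflection b (plane 1 0))"
    by (simp add: assms)
  then have "q = - q"
    unfolding reflection_plane plane_eq_iff by simp
  then show "p = 0" "q = 0"
    by (simp_all add: p_def q_def inner_commute simple_pair_nonzero)
qed

text \<open>The relation gives \<open>p * q = 1\<close>. Then reflecting \<open>a\<close> in
  \<open>b\<close> and the result in \<open>a\<close> yields the root \<open>q *\<^sub>R b\<close>,
  and the only positive multiple of \<open>b\<close> among the roots is \<open>b\<close>.\<close>

lemma Cartan_order_three:
  assumes "(reflection a \<circ> reflection b) ^^ 3 = id"
  shows "p = 1" "q = 1"
proof -
  have "((reflection a \<circ> reflection b) ^^ 3) (reflection b (reflection a (plane 1 0))) =
      reflection a (reflection b (reflection a (reflection b (plane 1 0))))"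
    using simple_pair_nonzero by (simp add: eval_nat_numeral reflection_involution)
  then have "reflection b (reflection a (plane 1 0)) =
      reflection a (reflection b (reflection a (reflection b (plane 1 0))))"
    by (simp add: assms)
  then have eqs: "- 1 = p * (q * (p * q - 1) - q) - (p * q - 1)" "- q = q * (p * q - 1) - q"
    unfolding reflection_plane plane_eq_iff by simp_all
  have "q * (p * q - 1) = 0"
    using eqs(2) by simp
  moreover have "q \<noteq> 0"
    using eqs(1) by auto
  ultimately have pq: "p * q = 1"
    by simp
  have "plane (p * q - 1) q \<in> \<Phi>"
    using reflection_plane_in_roots(1)[OF reflection_plane_in_roots(2)[OF plane_1_0_in_roots]]
    by simp
  then have "q *\<^sub>R b \<in> \<Phi>"
    using pq by simp
  then have "q = 1"
    using multiple_in_roots[of b q] ab simple_subset_roots Cartan_nonneg by auto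
  then show "p = 1" "q = 1"
    using pq by auto
qed

text \<open>The relation only yields a quadratic equation for \<open>p * q\<close>, which is four
  times the squared cosine of the angle. The sign condition selects its solution, and a root
  proportional to \<open>b\<close> then determines \<open>q\<close>.\<close>

lemma Cartan_order_five:
  assumes "(reflection a \<circ> reflection b) ^^ 5 = id"
  shows "p = golden" "q = golden"
proof -
  define k where "k = p * q"
  have "((reflection a \<circ> reflection b) ^^ 5) (reflection b (reflection a (reflection b
      (reflection a (plane 1 0))))) =
      reflection a (reflection b (reflection a (reflection b (reflection a (reflection b (plane 1 0))))))"
    using simple_pair_nonzero by (simp add: eval_nat_numeral reflection_involution)
  then have "reflection b (reflection a (reflection b (reflection a (plane 1 0)))) =
      reflection a (reflection b (reflection a (reflection b (reflection a (reflection b (plane 1 0))))))"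
    by (simp add: assms)
  then have eqs: "1 - k = k * (k\<^sup>2 - 4 * k + 3) - (k\<^sup>2 - 3 * k + 1)"
      "q * (2 - k) = q * (k\<^sup>2 - 4 * k + 3)"
    unfolding reflection_plane plane_eq_iff k_def by (simp_all add: algebra_simps power2_eq_square)
  have q: "0 < q"
    using eqs(1) Cartan_nonneg by (cases "q = 0") (auto simp: k_def)
  have "k\<^sup>2 - 3 * k + 1 = 0"
    using eqs(2) q by simp
  \<comment> \<open>The two solutions are the squares of \<open>golden\<close> and of its reciprocal
    \<open>golden - 1\<close>.\<close>
  then have "(k - (golden + 1)) * (k - (2 - golden)) = 0"
    using golden_square by (simp add: algebra_simps power2_eq_square)
  then have "k = golden + 1 \<or> k = 2 - golden"
    by simp
  \<comment> \<open>The second solution, angle \<open>3\<pi>/5\<close> between \<open>a\<close> and \<open>b\<close>, would yield a root with coefficients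
    of both signs.\<close>
  moreover have root: "plane (k - 1) q \<in> \<Phi>"
    using reflection_plane_in_roots(1)[OF reflection_plane_in_roots(2)[OF plane_1_0_in_roots]]
    by (simp add: k_def)
  then have "1 \<le> k"
    using plane_root_sign q by fastforce
  ultimately have k: "k = golden + 1"
    using golden_bounds by auto
  \<comment> \<open>This is the image of \<open>a\<close> under the square of
    \<open>reflection a \<circ> reflection b\<close>. Its first coordinate vanishes by the quadratic
    equation, so it is a multiple of \<open>b\<close>.\<close>
  have "plane (k\<^sup>2 - 3 * k + 1) (q * (k - 2)) \<in> \<Phi>"
    using reflection_plane_in_roots(1)[OF reflection_plane_in_roots(2)[OF root]]
    by (simp add: k_def algebra_simps power2_eq_square)
  then have "(q * (golden - 1)) *\<^sub>R b \<in> \<Phi>"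
    using \<open>k\<^sup>2 - 3 * k + 1 = 0\<close> k by simp
  then have "q * (golden - 1) = 1 \<or> q * (golden - 1) = -1"
    using multiple_in_roots[of b "q * (golden - 1)"] ab simple_subset_roots by auto
  moreover have "0 < q * (golden - 1)"
    using q golden_bounds by auto
  ultimately have "q * (golden - 1) = 1"
    by linarith
  moreover have "golden * (golden - 1) = 1"
    using golden_square by (simp add: algebra_simps)
  ultimately show "q = golden"
    using golden_bounds by (metis mult_cancel_right mult_zero_right zero_neq_one)
  then have "p * golden = golden * golden"
    using k golden_square by (simp add: k_def)
  then show "p = golden"
    using golden_bounds by simp
qed

end

end

text \<open>The coordinate form of \<open>reflection_pos\<close>. With it the induction over
  positive roots never leaves the list.\<close>

lemma H3_coeffs_reflection:
  assumes "(x, y, z) \<in> H3_coeffs golden"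
  shows "(x, y, z) \<noteq> (1, 0, 0) \<Longrightarrow> (golden * y - x, y, z) \<in> H3_coeffs golden"
    and "(x, y, z) \<noteq> (0, 1, 0) \<Longrightarrow> (x, golden * x + z - y, z) \<in> H3_coeffs golden"
    and "(x, y, z) \<noteq> (0, 0, 1) \<Longrightarrow> (x, y, y - z) \<in> H3_coeffs golden"
proof -
  have "golden * (golden * 2) = golden * 2 + 2"
    using golden_square by simp
  then have closed:
    "\<forall>(x, y, z)\<in>H3_coeffs golden. (x, y, z) \<noteq> (1, 0, 0) \<longrightarrow> (golden * y - x, y, z) \<in> H3_coeffs golden"
    "\<forall>(x, y, z)\<in>H3_coeffs golden. (x, y, z) \<noteq> (0, 1, 0) \<longrightarrow> (x, golden * x + z - y, z) \<in> H3_coeffs golden"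
    "\<forall>(x, y, z)\<in>H3_coeffs golden. (x, y, z) \<noteq> (0, 0, 1) \<longrightarrow> (x, y, y - z) \<in> H3_coeffs golden"
    unfolding H3_coeffs_def by (simp_all add: algebra_simps golden_square)
  show "(x, y, z) \<noteq> (1, 0, 0) \<Longrightarrow> (golden * y - x, y, z) \<in> H3_coeffs golden"
    and "(x, y, z) \<noteq> (0, 1, 0) \<Longrightarrow> (x, golden * x + z - y, z) \<in> H3_coeffs golden"
    and "(x, y, z) \<noteq> (0, 0, 1) \<Longrightarrow> (x, y, y - z) \<in> H3_coeffs golden"
    using closed[THEN bspec, OF assms] by simp_all
qed

lemma H3_coeffs_nonneg:
  assumes "(x, y, z) \<in> H3_coeffs golden"
  shows "0 \<le> x" "0 \<le> y" "0 \<le> z"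
proof -
  have "\<forall>(x, y, z)\<in>H3_coeffs golden. 0 \<le> x \<and> 0 \<le> y \<and> 0 \<le> z"
    using golden_bounds unfolding H3_coeffs_def by simp
  then show "0 \<le> x" "0 \<le> y" "0 \<le> z"
    using assms by auto
qed

section \<open>Reflections and positive roots in coordinates\<close>

context simple_root_system
begin

context
  fixes a1 a2 a3 :: 'a
  assumes simple: "\<Delta> = {a1, a2, a3}" "a1 \<noteq> a2" "a1 \<noteq> a3" "a2 \<noteq> a3"
    and relations: "(reflection a1 \<circ> reflection a2) ^^ 5 = id"
      "(reflection a2 \<circ> reflection a3) ^^ 3 = id" "(reflection a1 \<circ> reflection a3) ^^ 2 = id"
begin

abbreviation comb :: "real \<Rightarrow> real \<Rightarrow> real \<Rightarrow> 'a" where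
  "comb x y z \<equiv> x *\<^sub>R a1 + y *\<^sub>R a2 + z *\<^sub>R a3"

lemma simple_H3: "a1 \<in> \<Delta>" "a2 \<in> \<Delta>" "a3 \<in> \<Delta>"
  using simple by auto

lemma ball_simple_H3: "(\<forall>\<alpha>\<in>\<Delta>. P \<alpha>) \<longleftrightarrow> P a1 \<and> P a2 \<and> P a3"
  using simple by auto

lemma coord_comb: "coord (comb x y z) a1 = x" "coord (comb x y z) a2 = y" "coord (comb x y z) a3 = z"
  using simple(2-4) simple_H3 by (simp_all add: coord_simps)

lemma reflection_H3:
  "reflection a1 (comb x y z) = comb (golden * y - x) y z"
  "reflection a2 (comb x y z) = comb x (golden * x + z - y) z"
  "reflection a3 (comb x y z) = comb x y (y - z)"
proof -
  have nz: "a1 \<noteq> 0" "a2 \<noteq> 0" "a3 \<noteq> 0"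
    using simple_H3 simple_subset_roots zero_notin_roots by auto
  \<comment> \<open>The Cartan numbers fix every mixed inner product relative to the squared length
    of one root. In the quotients below the lengths cancel, so arbitrary root lengths are
    covered.\<close>
  have inner: "a2 \<bullet> a1 = - golden * (a1 \<bullet> a1) / 2" "a3 \<bullet> a1 = 0"
    "a1 \<bullet> a2 = - golden * (a2 \<bullet> a2) / 2" "a3 \<bullet> a2 = - (a2 \<bullet> a2) / 2"
    "a1 \<bullet> a3 = 0" "a2 \<bullet> a3 = - (a3 \<bullet> a3) / 2"
    using Cartan_order_five[OF simple_H3(1,2) simple(2) relations(1)]
      Cartan_order_three[OF simple_H3(2,3) simple(4) relations(2)]
      Cartan_order_two[OF simple_H3(1,3) simple(3) relations(3)] nz
    by (simp_all add: field_simps)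
  have "2 * (comb x y z \<bullet> a1) / (a1 \<bullet> a1) = x + x - golden * y"
    "2 * (comb x y z \<bullet> a2) / (a2 \<bullet> a2) = y + y - golden * x - z"
    "2 * (comb x y z \<bullet> a3) / (a3 \<bullet> a3) = z + z - y"
    using nz by (simp_all add: inner_add_left inner field_simps)
  then show "reflection a1 (comb x y z) = comb (golden * y - x) y z"
    "reflection a2 (comb x y z) = comb x (golden * x + z - y) z"
    "reflection a3 (comb x y z) = comb x y (y - z)"
    unfolding reflection_def by (simp_all only: scaleR_add_left scaleR_diff_left) simp_all
qed

lemma reflection_H3_in_roots:
  assumes "comb x y z \<in> \<Phi>"
  shows "comb (golden * y - x) y z \<in> \<Phi>" "comb x (golden * x + z - y) z \<in> \<Phi>" "comb x y (y - z) \<in> \<Phi>"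
  using assms simple_H3 simple_subset_roots reflection_in_roots reflection_H3 by (metis subsetD)+

text \<open>Each listed vector beyond the simple roots is the image of an earlier one under a simple
  reflection.\<close>

lemma H3_coeffs_in_roots:
  assumes "(x, y, z) \<in> H3_coeffs golden"
  shows "comb x y z \<in> \<Phi>"
proof -
  have r0: "comb 1 0 0 \<in> \<Phi>" and r1: "comb 0 1 0 \<in> \<Phi>" and r2: "comb 0 0 1 \<in> \<Phi>"
    using simple_H3 simple_subset_roots by auto
  have r3: "comb 1 golden 0 \<in> \<Phi>"
    using reflection_H3_in_roots(2)[OF r0] by (simp add: algebra_simps golden_square)
  have r4: "comb golden 1 0 \<in> \<Phi>"
    using reflection_H3_in_roots(1)[OF r1] by (simp add: algebra_simps golden_square)
  have r5: "comb 0 1 1 \<in> \<Phi>"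
    using reflection_H3_in_roots(3)[OF r1] by (simp add: algebra_simps golden_square)
  have r6: "comb golden golden 0 \<in> \<Phi>"
    using reflection_H3_in_roots(1)[OF r3] by (simp add: algebra_simps golden_square)
  have r7: "comb 1 golden golden \<in> \<Phi>"
    using reflection_H3_in_roots(3)[OF r3] by (simp add: algebra_simps golden_square)
  have r8: "comb golden 1 1 \<in> \<Phi>"
    using reflection_H3_in_roots(3)[OF r4] by (simp add: algebra_simps golden_square)
  have r9: "comb golden golden golden \<in> \<Phi>"
    using reflection_H3_in_roots(3)[OF r6] by (simp add: algebra_simps golden_square)
  have r10: "comb golden (golden + 1) 1 \<in> \<Phi>"
    using reflection_H3_in_roots(2)[OF r8] by (simp add: algebra_simps golden_square)
  have r11: "comb golden (golden + 1) golden \<in> \<Phi>"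
    using reflection_H3_in_roots(2)[OF r9] by (simp add: algebra_simps golden_square)
  have r12: "comb (golden + 1) (golden + 1) 1 \<in> \<Phi>"
    using reflection_H3_in_roots(1)[OF r10] by (simp add: algebra_simps golden_square)
  have r13: "comb (golden + 1) (golden + 1) golden \<in> \<Phi>"
    using reflection_H3_in_roots(1)[OF r11] by (simp add: algebra_simps golden_square)
  have r14: "comb (golden + 1) (2 * golden) golden \<in> \<Phi>"
    using reflection_H3_in_roots(2)[OF r13] by (simp add: algebra_simps golden_square)
  have "\<forall>(x, y, z)\<in>H3_coeffs golden. comb x y z \<in> \<Phi>"
    using r0 r1 r2 r3 r4 r5 r6 r7 r8 r9 r10 r11 r12 r13 r14 unfolding H3_coeffs_def by simp
  then show ?thesis
    using assms by auto
qed

text \<open>Induction by raising reflections shows that the list is complete; the converse inclusion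
  is \<open>H3_coeffs_in_roots\<close> with nonnegativity of the coefficients.\<close>

lemma pos_H3: "pos = (\<lambda>(x, y, z). comb x y z) ` H3_coeffs golden"
proof (intro equalityI subsetI)
  fix \<beta> assume "\<beta> \<in> pos"
  then show "\<beta> \<in> (\<lambda>(x, y, z). comb x y z) ` H3_coeffs golden"
  proof (induction rule: pos_root_induct)
    case (simple \<alpha>)
    have "\<alpha> = comb 1 0 0 \<or> \<alpha> = comb 0 1 0 \<or> \<alpha> = comb 0 0 1"
      using simple \<open>\<Delta> = {a1, a2, a3}\<close> by auto
    moreover have "(1, 0, 0) \<in> H3_coeffs golden" "(0, 1, 0) \<in> H3_coeffs golden"
      "(0, 0, 1) \<in> H3_coeffs golden"
      by (simp_all add: H3_coeffs_def)
    ultimately show ?case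
      by (metis (mono_tags, lifting) image_eqI case_prod_conv)
  next
    case (step \<beta> \<alpha>)
    then obtain x y z where \<beta>: "\<beta> = comb x y z" "(x, y, z) \<in> H3_coeffs golden"
      by auto
    have "\<beta> \<noteq> \<alpha>"
      using \<open>\<beta> \<bullet> \<alpha> < 0\<close> inner_ge_zero[of \<alpha>] by (metis not_less)
    consider "\<alpha> = a1" | "\<alpha> = a2" | "\<alpha> = a3"
      using step simple by auto
    then obtain x' y' z' where "reflection \<alpha> \<beta> = comb x' y' z'" "(x', y', z') \<in> H3_coeffs golden"
    proof cases
      case 1
      then have "(x, y, z) \<noteq> (1, 0, 0)"
        using \<beta> \<open>\<beta> \<noteq> \<alpha>\<close> by auto
      then show ?thesis
        using that 1 \<beta> reflection_H3(1) H3_coeffs_reflection(1) by blast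
    next
      case 2
      then have "(x, y, z) \<noteq> (0, 1, 0)"
        using \<beta> \<open>\<beta> \<noteq> \<alpha>\<close> by auto
      then show ?thesis
        using that 2 \<beta> reflection_H3(2) H3_coeffs_reflection(2) by blast
    next
      case 3
      then have "(x, y, z) \<noteq> (0, 0, 1)"
        using \<beta> \<open>\<beta> \<noteq> \<alpha>\<close> by auto
      then show ?thesis
        using that 3 \<beta> reflection_H3(3) H3_coeffs_reflection(3) by blast
    qed
    then show ?case
      by (metis (mono_tags, lifting) image_eqI case_prod_conv)
  qed
next
  fix \<beta> assume "\<beta> \<in> (\<lambda>(x, y, z). comb x y z) ` H3_coeffs golden"
  then obtain x y z where \<beta>: "\<beta> = comb x y z" "(x, y, z) \<in> H3_coeffs golden"
    by auto
  have "nonneg_comb \<Delta> \<beta>"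
    using H3_coeffs_nonneg[OF \<beta>(2)] by (simp add: nonneg_comb_iff ball_simple_H3 \<beta>(1) coord_comb)
  then show "\<beta> \<in> pos"
    using H3_coeffs_in_roots \<beta> by (simp add: positive_roots_def)
qed

theorem H3_separates:
  assumes I: "I \<in> increasing_sets \<Phi> \<Delta>"
  shows "\<exists>v. separates v I"
proof -
  have up: "comb x y z \<in> I \<longrightarrow> comb x' y' z' \<in> I"
    if "(x', y', z') \<in> H3_coeffs golden" "x \<le> x'" "y \<le> y'" "z \<le> z'" for x y z x' y' z'
  proof -
    have "root_le \<Delta> (comb x y z) (comb x' y' z')"
      using that by (simp add: root_le_iff ball_simple_H3 coord_comb)
    moreover have "comb x' y' z' \<in> pos"
      using that(1) unfolding pos_H3 by force
    ultimately show ?thesis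
      using I by (auto simp: increasing_sets_def)
  qed
  have "\<exists>x y z. 0 < x \<and> 0 < y \<and> 0 < z \<and>
    side (comb 1 0 0 \<in> I) x \<and>
    side (comb 0 1 0 \<in> I) y \<and>
    side (comb 0 0 1 \<in> I) z \<and>
    side (comb 1 golden 0 \<in> I) (x + golden * y) \<and>
    side (comb golden 1 0 \<in> I) (golden * x + y) \<and>
    side (comb 0 1 1 \<in> I) (y + z) \<and>
    side (comb golden golden 0 \<in> I) (golden * x + golden * y) \<and>
    side (comb 1 golden golden \<in> I) (x + golden * y + golden * z) \<and>
    side (comb golden 1 1 \<in> I) (golden * x + y + z) \<and>
    side (comb golden golden golden \<in> I) (golden * x + golden * y + golden * z) \<and>
    side (comb golden (golden + 1) 1 \<in> I) (golden * x + ((golden + 1)) * y + z) \<and>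
    side (comb golden (golden + 1) golden \<in> I) (golden * x + ((golden + 1)) * y + golden * z) \<and>
    side (comb (golden + 1) (golden + 1) 1 \<in> I) (((golden + 1)) * x + ((golden + 1)) * y + z) \<and>
    side (comb (golden + 1) (golden + 1) golden \<in> I) (((golden + 1)) * x + ((golden + 1)) * y + golden * z) \<and>
    side (comb (golden + 1) (2 * golden) golden \<in> I) (((golden + 1)) * x + (2 * golden) * y + golden * z)"
    \<comment> \<open>Each cover relation is discharged by \<open>up\<close>, comparing coefficients
      with the bounds on \<open>golden\<close>.\<close>
    by (rule golden_upset_separated[OF golden_bounds]; rule up)
      (use golden_bounds in \<open>simp_all add: H3_coeffs_def\<close>)
  then obtain x y z where xyz: "0 < x" "0 < y" "0 < z"
    and "\<forall>(x', y', z')\<in>H3_coeffs golden. side (comb x' y' z' \<in> I) (x' * x + y' * y + z' * z)"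
    unfolding H3_coeffs_def by auto
  then have side: "side (comb x' y' z' \<in> I) (x' * x + y' * y + z' * z)"
    if "(x', y', z') \<in> H3_coeffs golden" for x' y' z'
    using that by auto
  obtain v where v: "v \<bullet> a1 = x" "v \<bullet> a2 = y" "v \<bullet> a3 = z"
    using dual_vector_exists[of "\<lambda>\<alpha>. if \<alpha> = a1 then x else if \<alpha> = a2 then y else z"] simple(2-4)
    by (auto simp: ball_simple_H3)
  have sideI: "side (\<beta> \<in> I) (v \<bullet> \<beta>)" if "\<beta> \<in> pos" for \<beta>
    using that side v unfolding pos_H3 by (auto simp: inner_add_right)
  have "v \<in> dominant_chamber \<Delta>"
    using xyz v by (simp add: dominant_chamber_def ball_simple_H3)
  moreover have "I \<subseteq> pos"
    using I by (simp add: increasing_sets_def)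
  ultimately have "separates v I"
    using sideI unfolding separates_def side_def by (metis DiffE subsetD)
  then show ?thesis ..
qed

end

lemma type_H3_separates:
  assumes "type_H3 \<Phi> \<Delta>" "I \<in> increasing_sets \<Phi> \<Delta>"
  shows "\<exists>v. separates v I"
proof -
  obtain \<alpha> :: "nat \<Rightarrow> 'a" where bij: "bij_betw \<alpha> {1, 2, 3} \<Delta>"
    and cox: "coxeter_system (reflection_group \<Phi>) {1, 2, 3} (\<lambda>i. reflection (\<alpha> i)) H3_matrix"
    using assms(1) by (auto simp: type_H3_def)
  have \<Delta>: "\<Delta> = {\<alpha> 1, \<alpha> 2, \<alpha> 3}" "\<alpha> 1 \<noteq> \<alpha> 2" "\<alpha> 1 \<noteq> \<alpha> 3" "\<alpha> 2 \<noteq> \<alpha> 3"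
    using bij by (auto simp: bij_betw_def)
  have nz: "\<alpha> 1 \<noteq> 0" "\<alpha> 2 \<noteq> 0" "\<alpha> 3 \<noteq> 0"
    using \<Delta>(1) simple_subset_roots zero_notin_roots by auto
  have m: "H3_matrix 1 2 = 5" "H3_matrix 2 3 = 3" "H3_matrix 1 3 = 2"
    by (auto simp: H3_matrix_def doubleton_eq_iff)
  have "(reflection (\<alpha> 1) \<circ> reflection (\<alpha> 2)) ^^ 5 = id"
    using coxeter_system_relation[OF cox, of 1 2] nz m by simp
  moreover have "(reflection (\<alpha> 2) \<circ> reflection (\<alpha> 3)) ^^ 3 = id"
    using coxeter_system_relation[OF cox, of 2 3] nz m by simp
  moreover have "(reflection (\<alpha> 1) \<circ> reflection (\<alpha> 3)) ^^ 2 = id"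
    using coxeter_system_relation[OF cox, of 1 3] nz m by simp
  ultimately show ?thesis
    using H3_separates[OF \<Delta>] assms(2) by blast
qed

end

theorem theorem3p4:
  fixes \<Phi> \<Delta> :: "'a::euclidean_space set"
  assumes "root_system \<Phi>"
    and "simple_system \<Phi> \<Delta>"
    and "type_H3 \<Phi> \<Delta> \<or> (\<exists>m\<ge>2. type_I2 m \<Phi>)"
  shows "bij_betw (region_roots \<Phi> \<Delta>) (dominant_regions \<Phi> \<Delta>) (increasing_sets \<Phi> \<Delta>)"
proof -
  interpret simple_root_system \<Phi> \<Delta>
    using assms by unfold_locales
  show ?thesis
    using assms(3) type_H3_separates rank_two_separates
    by (intro region_roots_bij) (auto simp: type_I2_def)
qed

end
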